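(* For each of the following two pairs of polynomials $(f,g)$ of degree $6$, the hypergeometric group $H(f,g)$ is arithmetic: (1) $f(t)=t^6-t^5+t^4-t^3+t^2-t+1$ and $g(t)=(t^2+t+1)(t^4+t^3+t^2+t+1)$; (2) $f(t)=(t^2-t+1)(t^4-t^3+t^2-t+1)$ and $g(t)=t^6+t^5+t^4+t^3+t^2+t+1$.
   Context: For monic polynomials $f(t)=t^n+A_1t^{n-1}+\cdots+A_n$ and $g(t)=t^n+B_1t^{n-1}+\cdots+B_n$ in $\mathbb{Z}[t]$ with no common root in $\mathbb{C}$ and with $A_n,B_n\in\{1,-1\}$, let $A$ and $B$ be the companion matrices $$A=\begin{pmatrix}0&\cdots&0&-A_n\\1&\cdots&0&-A_{n-1}\\\vdots&\ddots&\vdots&\vdots\\0&\cdots&1&-A_1\end{pmatrix},\qquad B=\begin{pmatrix}0&\cdots&0&-B_n\\1&\cdots&0&-B_{n-1}\\\vdots&\ddots&\vdots&\vdots\\0&\cdots&1&-B_1\end{pmatrix},$$ and let $H(f,g)=\langle A,B^{-1}\rangle\leq \mathrm{GL}(n,\mathbb{Z})$. This is the hypergeometric group $H(a,b)$, where $a$ and $b$ are the lists of roots of $f$ and $g$ respectively. For the pairs considered here, $H(f,g)$ preserves a non-degenerate skew-symmetric bilinear form with rational matrix $\Phi$, unique up to a scalar multiple, so that $H(f,g)\leq \mathrm{Sp}(\Phi,\mathbb{Z})=\{h\in \mathrm{GL}(n,\mathbb{Z}) : h\Phi h^\top=\Phi\}$. The group $H(f,g)$ is called arithmetic if it has finite index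 in $\mathrm{Sp}(\Phi,\mathbb{Z})$. *)

theory Defs
  imports
    "HOL-Algebra.Generated_Groups"
    "Jordan_Normal_Form.Determinant"
    "HOL-Computational_Algebra.Polynomial"
begin

text \<open>Since \<open>f\<close> is monic of degree \<open>n\<close>, the coefficient \<open>A\<^sub>k\<close> of
  \<open>t\<^sup>n + A\<^sub>1 t\<^sup>n\<^sup>-\<^sup>1 + \<dots> + A\<^sub>n\<close> is \<open>coeff f (n - k)\<close>, so row \<open>i\<close> (counted from 0)
  of the last column is \<open>- coeff f i\<close>.\<close>

definition companion :: "int poly \<Rightarrow> int mat" where
  "companion f = mat (degree f) (degree f)
     (\<lambda>(i, j). if j = degree f - 1 then - coeff f i else if i = Suc j then 1 else 0)"

definition GL_int :: "nat \<Rightarrow> int mat monoid" where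
  "GL_int n = units_of (ring_mat TYPE(int) n ())"

text \<open>Meaningful for monic \<open>f\<close>, \<open>g\<close> of equal degree with constant terms \<open>\<plusminus>1\<close>: then both
  companion matrices lie in \<open>GL(n, \<int>)\<close>.\<close>

definition hypergeometric_group :: "int poly \<Rightarrow> int poly \<Rightarrow> int mat set" where
  "hypergeometric_group f g =
     generate (GL_int (degree f))
       {companion f, inv\<^bsub>GL_int (degree f)\<^esub> (companion g)}"

definition preserves_form :: "rat mat \<Rightarrow> int mat \<Rightarrow> bool" where
  "preserves_form \<Phi> h \<longleftrightarrow>
     map_mat rat_of_int h * \<Phi> * transpose_mat (map_mat rat_of_int h) = \<Phi>"

definition Sp_int :: "nat \<Rightarrow> rat mat \<Rightarrow> int mat set" where
  "Sp_int n \<Phi> = {h \<in> carrier (GL_int n). preserves_form \<Phi> h}"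

definition symplectic_form :: "nat \<Rightarrow> rat mat \<Rightarrow> bool" where
  "symplectic_form n \<Phi> \<longleftrightarrow>
     \<Phi> \<in> carrier_mat n n \<and> transpose_mat \<Phi> = - \<Phi> \<and> det \<Phi> \<noteq> 0"

definition invariant_symplectic_form :: "int poly \<Rightarrow> int poly \<Rightarrow> rat mat \<Rightarrow> bool" where
  "invariant_symplectic_form f g \<Phi> \<longleftrightarrow>
     symplectic_form (degree f) \<Phi> \<and> (\<forall>h \<in> hypergeometric_group f g. preserves_form \<Phi> h)"

definition finite_index_subgroup :: "'a set \<Rightarrow> ('a, 'b) monoid_scheme \<Rightarrow> bool" where
  "finite_index_subgroup H G \<longleftrightarrow> subgroup H G \<and> finite (rcosets\<^bsub>G\<^esub> H)"

text \<open>The invariant form is unique only up to a scalar multiple (which does not change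
  \<open>Sp_int\<close>), so the index condition is required for every choice of it; the existence conjunct
  keeps that condition from holding vacuously.\<close>

definition arithmetic_hypergeometric :: "int poly \<Rightarrow> int poly \<Rightarrow> bool" where
  "arithmetic_hypergeometric f g \<longleftrightarrow>
     (\<exists>\<Phi>. invariant_symplectic_form f g \<Phi>) \<and>
     (\<forall>\<Phi>. invariant_symplectic_form f g \<Phi> \<longrightarrow>
        finite_index_subgroup (hypergeometric_group f g)
          ((GL_int (degree f))\<lparr>carrier := Sp_int (degree f) \<Phi>\<rparr>))"

end

(*
  Each group turns out to be the full integral symplectic group of its form, so the index is 1.

  Write Sp for the group preserving the form J and let T_x = 1 + J x^T x be the transvection along a
  row vector x. Since A and B differ only in the last column, A^-1 B is (up to inversion) T_u for
  the last unit vector u. The set D of all x with T_x in H is stable under H, hence also under the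
  T_y with y in D. Starting from u, a chain of about fifty such moves reaches every vector of a
  symplectic basis e_i, f_i as well as all sums of two orthogonal members of it. The transvections
  along these vectors give all elementary symplectic matrices, and a Euclidean algorithm on the rows
  of a matrix shows that they generate Sp.

  The substitution t -> -t exchanges the two pairs, up to the order of f and g. In suitable
  symplectic bases the matrices B of the first pair and A of the second pair therefore agree up to
  sign, and the same chain serves both pairs.
*)

theory Submission
  imports Defs
begin

section \<open>Transvections\<close>

text \<open>Transvections along the basis vectors alone generate only a product of copies of
  SL(2,Z), one for each hyperbolic pair; the sums of two orthogonal basis vectors are what couples
  the pairs. The form J is unimodular: the rows of an integral invertible matrix P form a symplectic
  basis for it. Its stabiliser is therefore conjugate to Sp(6,Z) inside GL(6,Z), and index 1 is
  possible. J is normalised by the relation a T_u = b between the companion matrices, which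
  prescribes its last column. The vector [5, 3, -6, 0, -3, 4] at which the chain starts is u written
  in the basis P, that is, the last row of the inverse of P. Arithmeticity is demanded for every
  rational invariant form, so uniqueness of the form is needed on top of generation. It comes from
  the companion shape: invariance under one companion matrix determines the form by its last column,
  and comparing two companion matrices leaves a line for that column. Vectors are rows and matrices
  act from the right, in keeping with h J h^T = J.\<close>

definition symp_form :: "nat \<Rightarrow> int mat" where
  "symp_form n = mat (2 * n) (2 * n) (\<lambda>(i, j). if j = i + n then 1 else if i = j + n then - 1 else 0)"

text \<open>On rows from the right, for a single row x, this is v -> v + (v J x^T) x. The added term
  is quadratic in x, so x and -x give the same matrix.\<close>

definition transvection :: "int mat \<Rightarrow> int mat \<Rightarrow> int mat" where
  "transvection J x = 1\<^sub>m (dim_row J) + J * x\<^sup>T * x"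

definition preserves :: "int mat \<Rightarrow> int mat \<Rightarrow> bool" where
  "preserves J h \<longleftrightarrow> h * J * h\<^sup>T = J"

lemma transvection_carrier [simp]:
  assumes "J \<in> carrier_mat m m" "x \<in> carrier_mat k m"
  shows "transvection J x \<in> carrier_mat m m"
  using assms by (auto simp: transvection_def)

text \<open>Invariance g J g^T = J turns g J (x g)^T into J x^T. Hence conjugation by an invertible
  g carries the transvection along x to the one along x g.\<close>

lemma transvection_conj:
  assumes J: "J \<in> carrier_mat m m" and x: "x \<in> carrier_mat k m" and g: "g \<in> carrier_mat m m"
    and p: "preserves J g"
  shows "transvection J x * g = g * transvection J (x * g)"
proof -
  note c = J x g
  have "J * (g\<^sup>T * x\<^sup>T) * (x * g) \<in> carrier_mat m m"
    using c by (intro mult_carrier_mat[of _ m k] mult_carrier_mat[of _ m m]) auto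
  then have "g * transvection J (x * g) = g + g * (J * (g\<^sup>T * x\<^sup>T) * (x * g))"
    using c by (simp add: transvection_def mult_add_distrib_mat[of _ m m _ m] transpose_mult[of _ k m _ m])
  also have "g * (J * (g\<^sup>T * x\<^sup>T) * (x * g)) = (g * J * g\<^sup>T) * x\<^sup>T * (x * g)"
    using c by (simp add: assoc_mult_mat[of _ m m _ m _ k] assoc_mult_mat[of _ m m _ m _ m]
       assoc_mult_mat[of _ m m _ k _ m])
  also have "\<dots> = J * x\<^sup>T * x * g"
    using c p assoc_mult_mat[of "J * x\<^sup>T" m k x m g m] by (simp add: preserves_def)
  finally show ?thesis
    using c by (simp add: transvection_def add_mult_distrib_mat[of _ m m _ _ m])
qed

section \<open>Row vectors and the standard symplectic form\<close>

text \<open>Vectors are functions on all naturals, cut to m entries only when they become matrices;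
  changes of coordinates are then plain function updates.\<close>

definition rowf :: "nat \<Rightarrow> (nat \<Rightarrow> int) \<Rightarrow> int mat" where
  "rowf m v = mat 1 m (\<lambda>(_, j). v j)"

abbreviation unitf :: "nat \<Rightarrow> nat \<Rightarrow> int" where
  "unitf c \<equiv> (\<lambda>j. if j = c then 1 else 0)"

lemma rowf_carrier [simp]: "rowf m v \<in> carrier_mat 1 m" "rowf m v \<in> carrier_mat (Suc 0) m"
  by (simp_all add: rowf_def)

lemma rowf_eq_iff: "rowf m v = rowf m w \<longleftrightarrow> (\<forall>j<m. v j = w j)"
proof
  assume a: "rowf m v = rowf m w"
  show "\<forall>j<m. v j = w j"
  proof (intro allI impI)
    fix j assume "j < m"
    have "rowf m v $$ (0, j) = rowf m w $$ (0, j)" using a by simp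
    with \<open>j < m\<close> show "v j = w j" by (simp add: rowf_def)
  qed
qed (auto simp: rowf_def intro!: eq_matI)

lemma rowf_index: "x \<in> carrier_mat 1 m \<Longrightarrow> rowf m (\<lambda>j. x $$ (0, j)) = x"
  by (auto simp: rowf_def intro!: eq_matI)

definition omega :: "nat \<Rightarrow> (nat \<Rightarrow> int) \<Rightarrow> (nat \<Rightarrow> int) \<Rightarrow> int" where
  "omega n v w = (\<Sum>i<n. v i * w (i + n) - v (i + n) * w i)"

definition partner :: "nat \<Rightarrow> nat \<Rightarrow> nat" where
  "partner n c = (if c < n then c + n else c - n)"

text \<open>The sign for which \<open>omega n v (unitf c) = psign n c * v (partner n c)\<close>
  holds when \<open>c < 2 * n\<close>.\<close>

definition psign :: "nat \<Rightarrow> nat \<Rightarrow> int" where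
  "psign n c = (if c < n then - 1 else 1)"

lemma partner_simps [simp]:
  assumes "c < 2 * n"
  shows "partner n c < 2 * n" "partner n (partner n c) = c" "partner n c \<noteq> c"
    "psign n (partner n c) = - psign n c" "psign n c * psign n c = 1"
  using assms by (auto simp: partner_def psign_def)

lemma symp_form_carrier [simp]: "symp_form n \<in> carrier_mat (2 * n) (2 * n)"
  "dim_row (symp_form n) = 2 * n" "dim_col (symp_form n) = 2 * n"
  by (auto simp: symp_form_def)

lemma symp_form_index:
  "i < 2 * n \<Longrightarrow> j < 2 * n \<Longrightarrow> symp_form n $$ (i, j) = (if j = partner n i then - psign n i else 0)"
  by (auto simp: symp_form_def partner_def psign_def)

lemma symp_form_mult_col:
  assumes "i < 2 * n"
  shows "(symp_form n * (rowf (2 * n) x)\<^sup>T) $$ (i, 0) = - psign n i * x (partner n i)"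
proof -
  have "(symp_form n * (rowf (2 * n) x)\<^sup>T) $$ (i, 0) = (\<Sum>j<2*n. symp_form n $$ (i, j) * x j)"
    using assms by (simp add: scalar_prod_def rowf_def lessThan_atLeast0)
  also have "\<dots> = (\<Sum>j<2*n. if j = partner n i then - psign n i * x j else 0)"
    using assms by (intro sum.cong) (auto simp: symp_form_index)
  finally show ?thesis using assms by simp
qed

lemma sum_double: "(\<Sum>j<2*n. f j) = (\<Sum>j<n. f j + f (j + n) :: int)" for n :: nat
proof -
  have "{..<2*n} = {..<n} \<union> {n..<2*n}" by auto
  then have "sum f {..<2*n} = sum f {..<n} + sum f {n..<2*n}"
    by (simp add: sum.union_disjoint ivl_disj_int)
  also have "sum f {n..<2*n} = (\<Sum>j<n. f (j + n))"
    using sum.shift_bounds_nat_ivl[of f 0 n n] by (simp add: lessThan_atLeast0 mult_2)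
  finally show ?thesis by (simp add: sum.distrib)
qed

lemma rowf_form:
  "(rowf (2 * n) v * (symp_form n * (rowf (2 * n) x)\<^sup>T)) $$ (0, 0) = omega n v x"
proof -
  have "(rowf (2 * n) v * (symp_form n * (rowf (2 * n) x)\<^sup>T)) $$ (0, 0)
      = (\<Sum>j<2*n. v j * (symp_form n * (rowf (2 * n) x)\<^sup>T) $$ (j, 0))"
    by (simp add: scalar_prod_def rowf_def lessThan_atLeast0)
  also have "\<dots> = (\<Sum>j<2*n. v j * (- psign n j * x (partner n j)))"
    by (intro sum.cong) (auto simp: symp_form_mult_col)
  also have "\<dots> = omega n v x"
    by (auto simp: sum_double omega_def psign_def partner_def intro!: sum.cong)
  finally show ?thesis .
qed

lemma scalar_mat_mult_index:
  assumes "B \<in> carrier_mat 1 1" "x \<in> carrier_mat 1 m" "j < m"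
  shows "(B * x) $$ (0, j) = B $$ (0, 0) * x $$ (0, j)"
  using assms by (simp add: scalar_prod_def)

lemma rowf_transvection:
  "rowf (2 * n) v * transvection (symp_form n) (rowf (2 * n) x)
     = rowf (2 * n) (\<lambda>j. v j + omega n v x * x j)"
proof -
  let ?m = "2 * n" and ?J = "symp_form n"
  have c: "rowf ?m v \<in> carrier_mat 1 ?m" "rowf ?m x \<in> carrier_mat 1 ?m"
    "(rowf ?m x)\<^sup>T \<in> carrier_mat ?m 1" "?J \<in> carrier_mat ?m ?m" by auto
  have JX: "?J * (rowf ?m x)\<^sup>T \<in> carrier_mat ?m 1"
    by (rule mult_carrier_mat[OF c(4,3)])
  have "rowf ?m v * transvection ?J (rowf ?m x)
      = rowf ?m v * 1\<^sub>m ?m + rowf ?m v * (?J * (rowf ?m x)\<^sup>T * rowf ?m x)"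
    unfolding transvection_def symp_form_carrier
    by (rule mult_add_distrib_mat[OF c(1) one_carrier_mat mult_carrier_mat[OF JX c(2)]])
  also have "\<dots> = rowf ?m v + (rowf ?m v * (?J * (rowf ?m x)\<^sup>T)) * rowf ?m x"
    using assoc_mult_mat[OF c(1) JX c(2)] right_mult_one_mat[OF c(1)] by simp
  also have "\<dots> = rowf ?m (\<lambda>j. v j + omega n v x * x j)"
  proof (rule eq_matI)
    fix i j assume "i < dim_row (rowf ?m (\<lambda>j. v j + omega n v x * x j))"
      "j < dim_col (rowf ?m (\<lambda>j. v j + omega n v x * x j))"
    then have ij: "i = 0" "j < ?m" by (auto simp: rowf_def)
    let ?B = "rowf ?m v * (?J * (rowf ?m x)\<^sup>T)"
    have B: "?B \<in> carrier_mat 1 1" by (rule mult_carrier_mat[OF c(1) JX])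
    have "(?B * rowf ?m x) $$ (0, j) = ?B $$ (0, 0) * rowf ?m x $$ (0, j)"
      by (rule scalar_mat_mult_index[OF B c(2) ij(2)])
    then show "(rowf ?m v + ?B * rowf ?m x) $$ (i, j) = rowf ?m (\<lambda>j. v j + omega n v x * x j) $$ (i, j)"
      using ij B c by (simp add: rowf_form del: index_mult_mat(1)) (simp add: rowf_def)
  qed (auto simp: rowf_def)
  finally show ?thesis .
qed

lemma omega_self [simp]: "omega n v v = 0"
  by (simp add: omega_def mult.commute)

lemma omega_skew: "omega n v w = - omega n w v"
  by (simp add: omega_def sum_negf[symmetric] mult.commute)

lemma omega_add_left: "omega n (\<lambda>j. v j + w j) x = omega n v x + omega n w x"
  by (simp add: omega_def sum.distrib[symmetric] algebra_simps)

lemma omega_smult_left: "omega n (\<lambda>j. k * w j) x = k * omega n w x"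
  by (simp add: omega_def sum_distrib_left algebra_simps)

lemma omega_add_right: "omega n x (\<lambda>j. v j + w j) = omega n x v + omega n x w"
  by (simp add: omega_def sum.distrib[symmetric] algebra_simps)

lemma omega_unitf:
  assumes "c < 2 * n"
  shows "omega n v (unitf c) = psign n c * v (partner n c)"
proof -
  have "omega n v (unitf c) = (\<Sum>j<n. (if c = j + n then v j else 0) - (if j = c then v (j + n) else 0))"
    unfolding omega_def by (intro sum.cong) auto
  also have "\<dots> = (\<Sum>j<n. (if c = j + n then v j else 0)) - (\<Sum>j<n. (if j = c then v (j + n) else 0))"
    by (simp add: sum_subtractf)
  also have "(\<Sum>j<n. (if c = j + n then v j else 0)) = (\<Sum>j<n. if j = c - n \<and> n \<le> c then v j else 0)"
    by (intro sum.cong) auto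
  also have "\<dots> = (if n \<le> c then v (c - n) else 0)"
    using assms by (cases "n \<le> c") auto
  finally show ?thesis by (auto simp: psign_def partner_def)
qed

section \<open>Generation of the integral symplectic group\<close>

text \<open>(v M) J (w M)^T = v (M J M^T) w^T. Applied to unit vectors it says that the rows of M
  form a symplectic basis.\<close>

lemma symp_form_row_form:
  assumes M: "M \<in> carrier_mat (2 * n) (2 * n)" and p: "preserves (symp_form n) M"
  shows "omega n (\<lambda>j. (rowf (2 * n) v * M) $$ (0, j)) (\<lambda>j. (rowf (2 * n) w * M) $$ (0, j)) = omega n v w"
proof -
  let ?m = "2 * n" and ?J = "symp_form n" and ?v = "rowf (2 * n) v" and ?w = "rowf (2 * n) w"
  have c: "?v \<in> carrier_mat 1 ?m" "?w \<in> carrier_mat 1 ?m" "?J \<in> carrier_mat ?m ?m"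
    "M\<^sup>T \<in> carrier_mat ?m ?m" "?w\<^sup>T \<in> carrier_mat ?m 1"
    using M by auto
  have vM: "?v * M \<in> carrier_mat 1 ?m" "?w * M \<in> carrier_mat 1 ?m"
    using mult_carrier_mat[OF c(1) M] mult_carrier_mat[OF c(2) M] by auto
  have "omega n (\<lambda>j. (?v * M) $$ (0, j)) (\<lambda>j. (?w * M) $$ (0, j)) = (?v * M * (?J * (?w * M)\<^sup>T)) $$ (0, 0)"
    using rowf_form[of n "\<lambda>j. (?v * M) $$ (0, j)" "\<lambda>j. (?w * M) $$ (0, j)"]
    by (simp only: rowf_index[OF vM(1)] rowf_index[OF vM(2)])
  also have "(?w * M)\<^sup>T = M\<^sup>T * ?w\<^sup>T"
    by (rule transpose_mult[OF c(2) M])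
  also have "?v * M * (?J * (M\<^sup>T * ?w\<^sup>T)) = ?v * (M * (?J * (M\<^sup>T * ?w\<^sup>T)))"
    by (rule assoc_mult_mat[OF c(1) M mult_carrier_mat[OF c(3) mult_carrier_mat[OF c(4,5)]]])
  also have "?J * (M\<^sup>T * ?w\<^sup>T) = ?J * M\<^sup>T * ?w\<^sup>T"
    by (rule assoc_mult_mat[OF c(3,4,5), symmetric])
  also have "M * (?J * M\<^sup>T * ?w\<^sup>T) = M * (?J * M\<^sup>T) * ?w\<^sup>T"
    by (rule assoc_mult_mat[OF M mult_carrier_mat[OF c(3,4)] c(5), symmetric])
  also have "M * (?J * M\<^sup>T) = M * ?J * M\<^sup>T"
    by (rule assoc_mult_mat[OF M c(3,4), symmetric])
  also have "\<dots> = ?J" using p by (simp add: preserves_def)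
  finally show ?thesis by (simp add: rowf_form)
qed

lemma preserves_mult:
  assumes c: "J \<in> carrier_mat m m" "g \<in> carrier_mat m m" "h \<in> carrier_mat m m"
    and p: "preserves J g" "preserves J h"
  shows "preserves J (g * h)"
proof -
  have t: "h\<^sup>T \<in> carrier_mat m m" "g\<^sup>T \<in> carrier_mat m m" using c by auto
  have "g * h * J * (g * h)\<^sup>T = g * (h * J * h\<^sup>T) * g\<^sup>T"
    using c t by (simp add: transpose_mult[OF c(2,3)] assoc_mult_mat[of _ m m _ m _ m])
  then show ?thesis using p by (simp add: preserves_def)
qed

section \<open>Groups of integer matrices and their orbits on row vectors\<close>

text \<open>Stated for a bare set of matrices, because it is used both for a hypergeometric group
  and for its image under a change of basis.\<close>

locale matrix_subgroup =
  fixes m :: nat and K :: "int mat set"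
  assumes K_carrier: "h \<in> K \<Longrightarrow> h \<in> carrier_mat m m"
    and K_one: "1\<^sub>m m \<in> K"
    and K_mult: "g \<in> K \<Longrightarrow> h \<in> K \<Longrightarrow> g * h \<in> K"
    and K_inv: "h \<in> K \<Longrightarrow> \<exists>g\<in>K. h * g = 1\<^sub>m m \<and> g * h = 1\<^sub>m m"
begin

text \<open>\<open>F\<close> lists the basis vectors that the moving element must fix: the rows that
  the reduction has already brought to unit vectors.\<close>

definition reach :: "nat set \<Rightarrow> (nat \<Rightarrow> int) \<Rightarrow> (nat \<Rightarrow> int) \<Rightarrow> bool" where
  "reach F v w \<longleftrightarrow> (\<exists>h\<in>K. rowf m v * h = rowf m w \<and>
    (\<forall>c\<in>F. rowf m (unitf c) * h = rowf m (unitf c)))"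

lemma reach_refl: "reach F v v"
  unfolding reach_def by (rule bexI[OF _ K_one]) (simp add: right_mult_one_mat[OF rowf_carrier(1)])

lemma reach_trans:
  assumes "reach F u v" "reach F v w"
  shows "reach F u w"
proof -
  obtain g h where g: "g \<in> K" "rowf m u * g = rowf m v"
      "\<forall>c\<in>F. rowf m (unitf c) * g = rowf m (unitf c)"
    and h: "h \<in> K" "rowf m v * h = rowf m w"
      "\<forall>c\<in>F. rowf m (unitf c) * h = rowf m (unitf c)"
    using assms unfolding reach_def by blast
  have a: "rowf m x * (g * h) = rowf m x * g * h" for x
    using assoc_mult_mat[OF rowf_carrier(1) K_carrier[OF g(1)] K_carrier[OF h(1)]] by simp
  show ?thesis
    unfolding reach_def by (rule bexI[OF _ K_mult[OF g(1) h(1)]]) (use g h in \<open>simp add: a\<close>)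
qed

lemma reach_sym:
  assumes "reach F v w"
  shows "reach F w v"
proof -
  obtain h where h: "h \<in> K" "rowf m v * h = rowf m w"
      "\<forall>c\<in>F. rowf m (unitf c) * h = rowf m (unitf c)"
    using assms unfolding reach_def by blast
  obtain g where g: "g \<in> K" "h * g = 1\<^sub>m m" using K_inv[OF h(1)] by blast
  have a: "rowf m x * h * g = rowf m x" for x
    using assoc_mult_mat[OF rowf_carrier(1) K_carrier[OF h(1)] K_carrier[OF g(1)], of x] g
      right_mult_one_mat[OF rowf_carrier(1), of m x] by simp
  show ?thesis
    unfolding reach_def by (rule bexI[OF _ g(1)]) (metis a h(2,3))
qed

lemma reach_cong:
  assumes "reach F v w" "\<And>j. j < m \<Longrightarrow> w j = w' j"
  shows "reach F v w'"
  using assms by (simp add: reach_def rowf_eq_iff[THEN iffD2])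
    (metis rowf_eq_iff)

end

locale symplectic_subgroup = matrix_subgroup "2 * n" K for n :: nat and K +
  assumes K_preserves: "h \<in> K \<Longrightarrow> preserves (symp_form n) h"
begin

text \<open>From T_x h = h T_(x h) and the invertibility of h within K. Being an equivalence, it
  lets the moves of the chain run in both directions.\<close>

lemma transvection_orbit:
  assumes h: "h \<in> K" and x: "x \<in> carrier_mat k (2 * n)"
  shows "transvection (symp_form n) (x * h) \<in> K \<longleftrightarrow> transvection (symp_form n) x \<in> K"
proof -
  let ?m = "2 * n" and ?J = "symp_form n"
  let ?T = "transvection ?J x" and ?U = "transvection ?J (x * h)"
  obtain g where g: "g \<in> K" "h * g = 1\<^sub>m ?m" "g * h = 1\<^sub>m ?m"
    using K_inv[OF h] by blast
  have c: "h \<in> carrier_mat ?m ?m" "g \<in> carrier_mat ?m ?m" using h g K_carrier by auto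
  have T: "?T \<in> carrier_mat ?m ?m" "?U \<in> carrier_mat ?m ?m"
    by (rule transvection_carrier[OF symp_form_carrier(1)] x mult_carrier_mat[OF x c(1)])+
  have conj: "?T * h = h * ?U"
    by (rule transvection_conj[OF symp_form_carrier(1) x c(1) K_preserves[OF h]])
  have "?U = g * h * ?U" using g(3) left_mult_one_mat[OF T(2)] by simp
  also have "\<dots> = g * (?T * h)" using assoc_mult_mat[OF c(2,1) T(2)] conj by simp
  finally have U_eq: "?U = g * (?T * h)" .
  have "?T = ?T * (h * g)" using g(2) right_mult_one_mat[OF T(1)] by simp
  also have "\<dots> = h * ?U * g" using assoc_mult_mat[OF T(1) c] conj by simp
  finally have "?T = h * ?U * g" .
  then show ?thesis using U_eq K_mult g(1) h by metis
qed

end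

section \<open>Elementary moves made of transvections\<close>

text \<open>The two assumptions supply the long and the short root elements of the symplectic
  group.\<close>

locale symplectic_transvections = symplectic_subgroup +
  assumes unit_transvection:
      "c < 2 * n \<Longrightarrow> transvection (symp_form n) (rowf (2 * n) (unitf c)) \<in> K"
    and sum_transvection:
      "\<lbrakk>c < 2 * n; d < 2 * n; d \<noteq> c; d \<noteq> partner n c\<rbrakk>
        \<Longrightarrow> transvection (symp_form n) (rowf (2 * n) (\<lambda>j. unitf c j + unitf d j)) \<in> K"
begin

text \<open>T_x fixes everything orthogonal to x, in particular x itself. So omega(v, x) is constant
  under iteration, and the k-th power adds k times the first increment; the condition on
  \<open>F\<close> makes the protected basis vectors orthogonal to x.\<close>

lemma reach_transvection_int:
  assumes T: "transvection (symp_form n) (rowf (2 * n) x) \<in> K"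
    and F: "\<forall>c\<in>F. omega n (unitf c) x = 0"
  shows "reach F v (\<lambda>j. v j + k * omega n v x * x j)"
proof -
  have one: "reach F v (\<lambda>j. v j + omega n v x * x j)" for v
    unfolding reach_def by (rule bexI[OF _ T]) (use F in \<open>simp add: rowf_transvection\<close>)
  have pos: "reach F v (\<lambda>j. v j + int k * omega n v x * x j)" for k :: nat and v
  proof (induction k)
    case 0
    show ?case by (simp add: reach_refl)
  next
    case (Suc k)
    let ?w = "\<lambda>j. v j + int k * omega n v x * x j"
    have "omega n ?w x = omega n v x"
      using omega_add_left[of n v "\<lambda>j. (int k * omega n v x) * x j" x]
        omega_smult_left[of n "int k * omega n v x" x x] by simp
    then have "reach F v (\<lambda>j. ?w j + omega n v x * x j)"
      using reach_trans[OF Suc one[of ?w]] by simp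
    then show ?case by (simp add: algebra_simps)
  qed
  show ?thesis
  proof (cases "k \<ge> 0")
    case True
    then show ?thesis using pos[of v "nat k"] by simp
  next
    case False
    \<comment> \<open>For negative k, the power with exponent -k leads from \<open>?w\<close> back
      to v, and \<open>reach_sym\<close> reverses it.\<close>
    let ?w = "\<lambda>j. v j + k * omega n v x * x j"
    have "omega n ?w x = omega n v x"
      using omega_add_left[of n v "\<lambda>j. (k * omega n v x) * x j" x]
        omega_smult_left[of n "k * omega n v x" x x] by simp
    then have "reach F ?w (\<lambda>j. ?w j + - k * omega n v x * x j)"
      using pos[of ?w "nat (- k)"] False by simp
    then show ?thesis using reach_sym by simp
  qed
qed

text \<open>A power of the transvection along e_c. The only basis vector it can move is the one with
  index \<open>partner n c\<close>, hence the condition on \<open>F\<close>.\<close>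

lemma reach_long:
  assumes c: "c < 2 * n" "partner n c \<notin> F" "F \<subseteq> {..<2 * n}"
  shows "reach F v (v(c := v c + k * v (partner n c)))"
proof -
  have F: "\<forall>d\<in>F. omega n (unitf d) (unitf c) = 0"
    using c by (auto simp: omega_unitf)
  have "reach F v (\<lambda>j. v j + (k * psign n c) * omega n v (unitf c) * unitf c j)"
    by (rule reach_transvection_int[OF unit_transvection[OF c(1)] F])
  then show ?thesis
    by (rule reach_cong) (use partner_simps(5)[OF c(1)] c in \<open>auto simp: omega_unitf algebra_simps\<close>)
qed

text \<open>For orthogonal e_p and e_q, the product T_p^(-k) T_q^(-k) T_(p+q)^k cancels the square
  terms and keeps k times the cross terms omega(v, e_p) e_q + omega(v, e_q) e_p.\<close>

lemma reach_short:
  assumes c: "p < 2 * n" "q < 2 * n" "q \<noteq> p" "q \<noteq> partner n p" "partner n p \<notin> F" "partner n q \<notin> F"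
    and F: "F \<subseteq> {..<2 * n}"
  shows "reach F v (v(q := v q + k * psign n p * v (partner n p),
                      p := v p + k * psign n q * v (partner n q)))"
proof -
  let ?s = "\<lambda>j. unitf p j + unitf q j"
  have np: "p \<noteq> partner n q" using c partner_simps(2) by metis
  have F1: "\<forall>d\<in>F. omega n (unitf d) (unitf p) = 0" "\<forall>d\<in>F. omega n (unitf d) (unitf q) = 0"
    using c by (auto simp: omega_unitf)
  then have F3: "\<forall>d\<in>F. omega n (unitf d) ?s = 0"
    by (simp add: omega_add_right)
  define w1 where "w1 = (\<lambda>j. v j + (- k) * omega n v (unitf p) * unitf p j)"
  define w2 where "w2 = (\<lambda>j. w1 j + (- k) * omega n w1 (unitf q) * unitf q j)"
  have "reach F v w1" unfolding w1_def
    by (rule reach_transvection_int[OF unit_transvection[OF c(1)] F1(1)])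
  moreover have "reach F w1 w2" unfolding w2_def
    by (rule reach_transvection_int[OF unit_transvection[OF c(2)] F1(2)])
  moreover have "reach F w2 (\<lambda>j. w2 j + k * omega n w2 ?s * ?s j)"
    by (rule reach_transvection_int[OF sum_transvection[OF c(1-4)] F3])
  ultimately have "reach F v (\<lambda>j. w2 j + k * omega n w2 ?s * ?s j)"
    using reach_trans by blast
  moreover have "(\<lambda>j. w2 j + k * omega n w2 ?s * ?s j)
     = v(q := v q + k * psign n p * v (partner n p), p := v p + k * psign n q * v (partner n q))"
    using c np partner_simps(3)[OF c(1)] partner_simps(3)[OF c(2)]
    by (auto simp: fun_eq_iff omega_add_right omega_unitf w2_def w1_def algebra_simps)
  ultimately show ?thesis by simp
qed

text \<open>The basic step of the Euclidean algorithm: a long root element if d is the partner of c,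
  otherwise a short one along \<open>partner n c\<close> and d, whose only side effect is on
  coordinate \<open>partner n c\<close>.\<close>

lemma reach_add:
  assumes c: "c < 2 * n" "d < 2 * n" "c \<noteq> d" "c \<notin> F" "partner n d \<notin> F" and F: "F \<subseteq> {..<2 * n}"
  obtains w where "reach F v w" "w d = v d + k * v c"
    "\<And>j. j \<noteq> d \<Longrightarrow> j \<noteq> partner n c \<Longrightarrow> w j = v j"
proof (cases "d = partner n c")
  case True
  then have "partner n d = c" using c by simp
  then have "reach F v (v(d := v d + k * v c))"
    using reach_long[of d F v k] c F by simp
  then show ?thesis by (rule that) auto
next
  case False
  let ?p = "partner n c"
  have p: "?p < 2 * n" "partner n ?p = c" using c by auto
  let ?w = "v(d := v d + k * psign n ?p * psign n ?p * v c,
       ?p := v ?p + k * psign n ?p * psign n d * v (partner n d))"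
  \<comment> \<open>The factor \<open>psign n ?p\<close> in the exponent cancels the sign at
    coordinate d, since signs square to 1.\<close>
  have "reach F v ?w"
    using reach_short[of ?p d F v "k * psign n ?p"] c F p False by simp
  moreover have "psign n ?p * psign n ?p = 1" by (rule partner_simps(5)[OF p(1)])
  ultimately show ?thesis
    by (intro that[of ?w]) (use False in \<open>auto simp: mult.assoc\<close>)
qed

section \<open>The Euclidean algorithm on primitive vectors\<close>

text \<open>The indices of the first i hyperbolic pairs, those that the reduction has already dealt
  with.\<close>

definition low_indices :: "nat \<Rightarrow> nat set" where
  "low_indices i = {..<i} \<union> {n..<n + i}"

text \<open>Equivalent to the first 2n coordinates having gcd 1, in a form that is visibly invariant
  under isometries.\<close>

definition primitive :: "(nat \<Rightarrow> int) \<Rightarrow> bool" where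
  "primitive v \<longleftrightarrow> (\<exists>y. omega n v y = 1)"

lemma low_indices_subset: "i \<le> n \<Longrightarrow> low_indices i \<subseteq> {..<2 * n}"
  by (auto simp: low_indices_def)

lemma partner_low_indices: "i \<le> n \<Longrightarrow> c < 2 * n \<Longrightarrow> partner n c \<in> low_indices i \<longleftrightarrow> c \<in> low_indices i"
  by (auto simp: low_indices_def partner_def)

lemma omega_cong:
  "(\<And>j. j < 2 * n \<Longrightarrow> v j = v' j) \<Longrightarrow> (\<And>j. j < 2 * n \<Longrightarrow> w j = w' j)
    \<Longrightarrow> omega n v w = omega n v' w'"
  unfolding omega_def by (intro sum.cong) auto

text \<open>The witness y is carried along: y h pairs to 1 with w = v h.\<close>

lemma omega_reach_primitive:
  assumes "primitive v" "reach F v w"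
  shows "primitive w"
proof -
  obtain y where y: "omega n v y = 1" using assms(1) by (auto simp: primitive_def)
  obtain h where h: "h \<in> K" "rowf (2 * n) v * h = rowf (2 * n) w"
    using assms(2) by (auto simp: reach_def)
  have "omega n w (\<lambda>j. (rowf (2 * n) y * h) $$ (0, j))
      = omega n (\<lambda>j. (rowf (2 * n) v * h) $$ (0, j)) (\<lambda>j. (rowf (2 * n) y * h) $$ (0, j))"
    by (intro omega_cong) (simp_all add: h(2), simp_all add: rowf_def)
  also have "\<dots> = 1"
    using symp_form_row_form[OF K_carrier[OF h(1)] K_preserves[OF h(1)]] y by simp
  finally show ?thesis by (auto simp: primitive_def)
qed

lemma primitive_dvd:
  assumes "primitive v" "\<And>c. c < 2 * n \<Longrightarrow> d dvd v c"
  shows "d dvd 1"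
proof -
  obtain y where y: "omega n v y = 1" using assms(1) by (auto simp: primitive_def)
  have "d dvd omega n v y" unfolding omega_def
    by (intro dvd_sum dvd_diff dvd_mult2 assms(2)) auto
  then show ?thesis using y by simp
qed

text \<open>Provides the positive entry at index i that the Euclidean descent starts from: a nonzero
  entry elsewhere is added to entry i, with the right sign and often enough to outweigh it.\<close>

lemma reach_positive:
  assumes i: "i < n" and v: "primitive v" "\<forall>c\<in>low_indices i. v c = 0"
  obtains w where "reach (low_indices i) v w" "w i > 0" "\<forall>c\<in>low_indices i. w c = 0"
proof -
  note goal = that
  have F: "low_indices i \<subseteq> {..<2 * n}" using low_indices_subset i by auto
  have nd: "i \<notin> low_indices i" "partner n i \<notin> low_indices i" "partner n i = n + i" "i < 2 * n"
    using i by (auto simp: low_indices_def partner_def)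
  \<comment> \<open>Stated for any u reachable from v, since the second case below must move v
    first.\<close>
  have *: thesis
    if u: "reach (low_indices i) v u" "\<forall>c\<in>low_indices i. u c = 0"
      and c: "c < 2 * n" "c \<noteq> i" "u c \<noteq> 0" for u c
  proof -
    have cd: "c \<notin> low_indices i" "partner n c \<notin> low_indices i"
      using c u(2) partner_low_indices[of i c] i by auto
    obtain w where w: "reach (low_indices i) u w" "w i = u i + (sgn (u c) * (\<bar>u i\<bar> + 1)) * u c"
       "\<And>j. j \<noteq> i \<Longrightarrow> j \<noteq> partner n c \<Longrightarrow> w j = u j"
      using reach_add[OF c(1) nd(4) c(2) cd(1) nd(2) F] by blast
    have "w i = u i + (\<bar>u i\<bar> + 1) * \<bar>u c\<bar>"
      using w(2) by (simp add: abs_sgn[of "u c"] mult.commute mult.left_commute)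
    moreover have "(\<bar>u i\<bar> + 1) * \<bar>u c\<bar> \<ge> (\<bar>u i\<bar> + 1) * 1"
      using c(3) by (intro mult_left_mono) auto
    ultimately have "w i \<ge> u i + (\<bar>u i\<bar> + 1)" by simp
    then have "w i > 0" by linarith
    moreover have "\<forall>c\<in>low_indices i. w c = 0" using w(3) u(2) nd cd by (metis)
    ultimately show thesis using goal reach_trans[OF u(1) w(1)] by blast
  qed
  show thesis
  proof (cases "\<exists>c<2 * n. c \<noteq> i \<and> v c \<noteq> 0")
    case True
    then show thesis using *[OF reach_refl v(2)] by blast
  next
    case False
    \<comment> \<open>Here v is a multiple of e_i. Its entry, nonzero by primitivity, is copied to
      coordinate \<open>n + i\<close>, after which \<open>*\<close> applies.\<close>
    have "v i \<noteq> 0"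
    proof
      assume "v i = 0"
      then have "0 dvd v c" if "c < 2 * n" for c using False that by (cases "c = i") auto
      then show False using primitive_dvd[OF v(1), of 0] by simp
    qed
    obtain w where w: "reach (low_indices i) v w" "w (n + i) = v (n + i) + 1 * v i"
       "\<And>j. j \<noteq> n + i \<Longrightarrow> j \<noteq> partner n i \<Longrightarrow> w j = v j"
    proof (rule reach_add[of i "n + i" "low_indices i" v 1])
      show "partner n (n + i) \<notin> low_indices i" using nd(1) by (simp add: partner_def)
    qed (use nd i F in auto)
    have "\<not> (n + i < 2 * n \<and> n + i \<noteq> i \<and> v (n + i) \<noteq> 0)" using False by blast
    then have "v (n + i) = 0" using i by simp
    then have "w (n + i) \<noteq> 0" using w(2) \<open>v i \<noteq> 0\<close> by simp
    moreover have "\<forall>c\<in>low_indices i. w c = 0" using w(3) v(2) nd by metis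
    ultimately show thesis using i by (intro *[OF w(1), of "n + i"]) auto
  qed
qed

text \<open>Euclidean descent on \<open>v i\<close>. As long as it exceeds 1, primitivity gives an
  entry that it does not divide; reducing that entry modulo \<open>v i\<close>, and then
  \<open>v i\<close> modulo the remainder, makes \<open>v i\<close> smaller and keeps it
  positive.\<close>

lemma reach_one:
  assumes i: "i < n" and "v i > 0" "primitive v" "\<forall>c\<in>low_indices i. v c = 0"
  shows "\<exists>w. reach (low_indices i) v w \<and> w i = 1 \<and> (\<forall>c\<in>low_indices i. w c = 0)"
  using assms(2-)
proof (induction "nat (v i)" arbitrary: v rule: less_induct)
  case less
  have F: "low_indices i \<subseteq> {..<2 * n}" using low_indices_subset i by auto
  have nd: "i \<notin> low_indices i" "partner n i \<notin> low_indices i" "i < 2 * n"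
    using i by (auto simp: low_indices_def partner_def)
  show ?case
  proof (cases "v i = 1")
    case True
    then show ?thesis using less.prems reach_refl by blast
  next
    case False
    have "\<exists>c<2 * n. \<not> v i dvd v c"
      using primitive_dvd[OF less.prems(2), of "v i"] False less.prems(1) by auto
    then obtain c where c: "c < 2 * n" "\<not> v i dvd v c" by blast
    have ci: "i \<noteq> c" using c by auto
    have cd: "c \<notin> low_indices i" "partner n c \<notin> low_indices i"
      using c less.prems(3) partner_low_indices[of i c] i by auto
    obtain u where u: "reach (low_indices i) v u" "u c = v c + (- (v c div v i)) * v i"
       "\<And>j. j \<noteq> c \<Longrightarrow> j \<noteq> partner n i \<Longrightarrow> u j = v j"
      using reach_add[OF nd(3) c(1) ci nd(1) cd(2) F] by blast
    have uc: "u c = v c mod v i" using u(2) by (simp add: minus_div_mult_eq_mod[symmetric])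
    then have uc2: "0 < u c" "u c < v i"
      using less.prems(1) pos_mod_bound[of "v i" "v c"] pos_mod_sign[of "v i" "v c"]
        c(2)[unfolded dvd_eq_mod_eq_0] by linarith+
    have ui: "u i = v i" using u(3) ci nd partner_simps(3) by metis
    \<comment> \<open>Dividing \<open>u i - 1\<close> instead of \<open>u i\<close> puts the new
      entry between 1 and \<open>u c\<close>, so that it cannot become 0.\<close>
    obtain w where w: "reach (low_indices i) u w" "w i = u i + (- ((u i - 1) div u c)) * u c"
       "\<And>j. j \<noteq> i \<Longrightarrow> j \<noteq> partner n c \<Longrightarrow> w j = u j"
      using reach_add[OF c(1) nd(3) ci[symmetric] cd(1) nd(2) F] by blast
    have "w i = (u i - 1) mod u c + 1"
      using w(2) by (simp add: minus_div_mult_eq_mod[symmetric])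
    then have wi: "0 < w i" "w i < v i"
      using uc2 pos_mod_bound[of "u c" "u i - 1"] pos_mod_sign[of "u c" "u i - 1"] by linarith+
    have uz: "\<forall>c\<in>low_indices i. u c = 0" using u(3) less.prems(3) nd cd by metis
    then have wz: "\<forall>c\<in>low_indices i. w c = 0" using w(3) nd cd by metis
    have vw: "reach (low_indices i) v w" using reach_trans u(1) w(1) by blast
    have "primitive w" using omega_reach_primitive less.prems(2) vw by blast
    then obtain x where "reach (low_indices i) w x \<and> x i = 1 \<and> (\<forall>c\<in>low_indices i. x c = 0)"
      using less.hyps[of w] wi wz by auto
    then show ?thesis using reach_trans vw by blast
  qed
qed

text \<open>Each coordinate is cleared by a multiple of the entry 1 at p. All side effects fall on
  \<open>partner n p\<close>, which is therefore cleared last, by a long root element. Apart from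
  that one only nonzero coordinates are treated, which is why \<open>free\<close> is restricted to
  them.\<close>

lemma reach_clear:
  assumes p: "p < 2 * n" "p \<notin> F" and F: "F \<subseteq> {..<2 * n}" and v: "v p = 1"
    and free: "\<And>c. c < 2 * n \<Longrightarrow> c \<noteq> p \<Longrightarrow> c \<noteq> partner n p \<Longrightarrow> v c \<noteq> 0
      \<Longrightarrow> partner n c \<notin> F"
  shows "reach F v (unitf p)"
proof -
  have pp: "partner n p < 2 * n" "partner n p \<noteq> p" using p partner_simps by auto
  have cl: "\<exists>w. reach F v w \<and> w p = 1 \<and> (\<forall>c. c \<noteq> partner n p \<longrightarrow> w c = (if c \<in> S then 0 else v c))"
    if "finite S" "S \<subseteq> {c. c < 2 * n \<and> c \<noteq> p \<and> c \<noteq> partner n p \<and> v c \<noteq> 0}" for S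
    using that
  proof (induction S)
    case empty
    show ?case using reach_refl v by (intro exI[of _ v]) auto
  next
    case (insert d S)
    then obtain w where w: "reach F v w" "w p = 1" "\<And>c. c \<noteq> partner n p \<Longrightarrow> w c = (if c \<in> S then 0 else v c)"
      by auto
    have d: "d < 2 * n" "p \<noteq> d" "d \<noteq> partner n p" "partner n d \<notin> F"
      using insert free by auto
    obtain u where u: "reach F w u" "u d = w d + (- w d) * w p"
       "\<And>j. j \<noteq> d \<Longrightarrow> j \<noteq> partner n p \<Longrightarrow> u j = w j"
      using reach_add[OF p(1) d(1,2) p(2) d(4) F] by blast
    have "reach F v u" using reach_trans w(1) u(1) by blast
    moreover have "u p = 1" using u(3)[of p] d pp w(2) by auto
    moreover have "u c = (if c \<in> insert d S then 0 else v c)" if "c \<noteq> partner n p" for c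
      using u(3)[of c] u(2) w(2) w(3)[of c] that by (cases "c = d") auto
    ultimately show ?case by blast
  qed
  obtain w where w: "reach F v w" "w p = 1"
    "\<And>c. c \<noteq> partner n p \<Longrightarrow> w c = (if c < 2 * n \<and> c \<noteq> p \<and> v c \<noteq> 0 then 0 else v c)"
    using cl[of "{c. c < 2 * n \<and> c \<noteq> p \<and> c \<noteq> partner n p \<and> v c \<noteq> 0}"] by auto
  have "partner n (partner n p) \<notin> F" using p by simp
  then obtain u where u: "reach F w u" "u (partner n p) = w (partner n p) + (- w (partner n p)) * w p"
       "\<And>j. j \<noteq> partner n p \<Longrightarrow> u j = w j"
    using reach_add[OF p(1) pp(1) pp(2)[symmetric] p(2) _ F] by metis
  have "u j = unitf p j" if "j < 2 * n" for j
    using that pp(2) u(3)[of j] u(2) w(2) w(3)[of j] by (cases "j = partner n p"; cases "j = p") auto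
  then show ?thesis by (rule reach_cong[OF reach_trans[OF w(1) u(1)]])
qed

lemma reach_unit:
  assumes i: "i < n" and v: "primitive v" "\<forall>c\<in>low_indices i. v c = 0"
  shows "reach (low_indices i) v (unitf i)"
proof -
  obtain w where w: "reach (low_indices i) v w" "w i > 0" "\<forall>c\<in>low_indices i. w c = 0"
    using reach_positive[OF i v] by blast
  obtain x where x: "reach (low_indices i) w x" "x i = 1" "\<forall>c\<in>low_indices i. x c = 0"
    using reach_one[OF i w(2) omega_reach_primitive[OF v(1) w(1)] w(3)] by blast
  have "reach (low_indices i) x (unitf i)"
    using i x low_indices_subset[of i] partner_low_indices[of i]
    by (intro reach_clear) (auto simp: low_indices_def)
  then show ?thesis using reach_trans w(1) x(1) by blast
qed

text \<open>With pivot \<open>n + i\<close>, every transvection involved is along a vector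
  orthogonal to e_i, so e_i can join the protected vectors.\<close>

lemma reach_unit_partner:
  assumes i: "i < n" and v: "v (n + i) = 1" "\<forall>c\<in>low_indices i. v c = 0"
  shows "reach (insert i (low_indices i)) v (unitf (n + i))"
proof -
  have "partner n c \<notin> insert i (low_indices i)" if "c < 2 * n" "v c \<noteq> 0" "c \<noteq> n + i" for c
    using that i v(2) partner_low_indices[of i c] by (auto simp: partner_def split: if_splits)
  then show ?thesis
    using i v low_indices_subset[of i] by (intro reach_clear) (auto simp: low_indices_def)
qed

section \<open>Reduction of a symplectic matrix to the identity\<close>

lemma fixes_row:
  assumes "M \<in> carrier_mat (2 * n) (2 * n)" "c < 2 * n"
  shows "rowf (2 * n) (unitf c) * M = rowf (2 * n) (\<lambda>j. M $$ (c, j))"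
proof (rule eq_matI)
  fix i j
  assume "i < dim_row (rowf (2 * n) (\<lambda>j. M $$ (c, j)))" "j < dim_col (rowf (2 * n) (\<lambda>j. M $$ (c, j)))"
  then have ij: "i = 0" "j < 2 * n" by (auto simp: rowf_def)
  have "(rowf (2 * n) (unitf c) * M) $$ (0, j) = (\<Sum>k<2*n. unitf c k * M $$ (k, j))"
    using ij assms by (simp add: scalar_prod_def rowf_def lessThan_atLeast0)
  also have "\<dots> = (\<Sum>k<2*n. if k = c then M $$ (k, j) else 0)"
    by (intro sum.cong) auto
  finally show "(rowf (2 * n) (unitf c) * M) $$ (i, j) = rowf (2 * n) (\<lambda>j. M $$ (c, j)) $$ (i, j)"
    using ij assms by (simp add: rowf_def)
qed (use assms in \<open>auto simp: rowf_def\<close>)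

text \<open>Induction on the number of hyperbolic pairs left. Row i is moved to e_i, then row
  \<open>n + i\<close> to its unit vector, by elements fixing all unit rows obtained before; when no
  pair is left the matrix is the identity.\<close>

lemma complete_reduction:
  assumes "M \<in> carrier_mat (2 * n) (2 * n)" "preserves (symp_form n) M" "i \<le> n"
    and "\<forall>c\<in>low_indices i. rowf (2 * n) (unitf c) * M = rowf (2 * n) (unitf c)"
  shows "\<exists>h\<in>K. M * h = 1\<^sub>m (2 * n)"
  using assms
proof (induction "n - i" arbitrary: M i)
  case 0
  let ?m = "2 * n"
  have "M = 1\<^sub>m ?m"
  proof (rule eq_matI)
    fix c j assume "c < dim_row (1\<^sub>m ?m :: int mat)" "j < dim_col (1\<^sub>m ?m :: int mat)"
    then have cj: "c < ?m" "j < ?m" by auto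
    moreover have "i = n" using 0 by simp
    ultimately have "c \<in> low_indices i" unfolding low_indices_def by auto
    then have "rowf ?m (\<lambda>j. M $$ (c, j)) = rowf ?m (unitf c)"
      using 0 fixes_row[OF _ cj(1)] by metis
    then show "M $$ (c, j) = 1\<^sub>m ?m $$ (c, j)" using cj by (auto simp: rowf_eq_iff)
  qed (use 0 in auto)
  then show ?case by (intro bexI[OF _ K_one]) simp
next
  case (Suc k)
  let ?m = "2 * n" and ?J = "symp_form n"
  let ?row = "\<lambda>M c j. (rowf ?m (unitf c) * M) $$ (0, j)"
  have i: "i < n" using Suc by auto
  have ortho: "omega n (?row M c) (?row M d) = omega n (unitf c) (unitf d)"
    if "M \<in> carrier_mat ?m ?m" "preserves ?J M" for M c d
    by (rule symp_form_row_form[OF that])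
  have rowf_row: "rowf ?m (?row M c) = rowf ?m (unitf c) * M" if "M \<in> carrier_mat ?m ?m" for M c
    by (rule rowf_index) (rule mult_carrier_mat[OF rowf_carrier(1) that])
  \<comment> \<open>Pairing with a row that is the unit vector e reads off column
    \<open>c = partner n e\<close>; since M is an isometry, every row other than row c vanishes
    there.\<close>
  have zero: "?row M d c = 0"
    if M: "M \<in> carrier_mat ?m ?m" "preserves ?J M"
      and fixed: "rowf ?m (unitf e) * M = rowf ?m (unitf e)"
      and e: "e = partner n c" "c < ?m" "d < ?m" "d \<noteq> c"
    for M c d e
  proof -
    have "omega n (?row M d) (?row M e) = omega n (?row M d) (unitf e)"
      using fixed by (intro omega_cong) (auto simp: rowf_def)
    then have "omega n (unitf d) (unitf e) = omega n (?row M d) (unitf e)"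
      using ortho[OF M, of d e] by simp
    moreover have "e < ?m" "partner n e = c" using e by auto
    ultimately have "psign n e * ?row M d c = 0" using e by (simp add: omega_unitf)
    then show ?thesis by (simp add: psign_def split: if_splits)
  qed
  have prod: "M * h \<in> carrier_mat ?m ?m" "preserves ?J (M * h)"
    "rowf ?m v * (M * h) = rowf ?m v * M * h"
    if "M \<in> carrier_mat ?m ?m" "preserves ?J M" "h \<in> K" for M h v
    using preserves_mult[OF symp_form_carrier(1) that(1) K_carrier[OF that(3)] that(2) K_preserves[OF that(3)]]
      assoc_mult_mat[OF rowf_carrier(1) that(1) K_carrier[OF that(3)]]
      mult_carrier_mat[OF that(1) K_carrier[OF that(3)]] by auto
  have M: "M \<in> carrier_mat ?m ?m" "preserves ?J M" using Suc by auto
  have pc: "partner n c \<in> low_indices i" "c < ?m" if "c \<in> low_indices i" for c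
    using that i partner_low_indices[of i c] low_indices_subset[of i] by auto
  \<comment> \<open>The witness is row \<open>n + i\<close>, which pairs with row i as the unit
    vectors do.\<close>
  have "primitive (?row M i)"
    using ortho[OF M, of i "n + i"] i
    by (auto simp: primitive_def omega_unitf psign_def partner_def intro!: exI[of _ "?row M (n + i)"])
  moreover have "\<forall>c\<in>low_indices i. ?row M i c = 0"
  proof
    fix c assume c: "c \<in> low_indices i"
    show "?row M i c = 0"
      by (rule zero[OF M _ refl]) (use c pc[OF c] Suc.prems i in \<open>auto simp: low_indices_def\<close>)
  qed
  ultimately obtain h where h: "h \<in> K" "rowf ?m (unitf i) * M * h = rowf ?m (unitf i)"
    "\<forall>c\<in>low_indices i. rowf ?m (unitf c) * h = rowf ?m (unitf c)"
    using reach_unit[OF i, of "?row M i"] rowf_row[OF M(1)] by (auto simp: reach_def)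
  define N where "N = M * h"
  have N: "N \<in> carrier_mat ?m ?m" "preserves ?J N"
    and N_fix: "rowf ?m (unitf i) * N = rowf ?m (unitf i)"
     "\<forall>c\<in>low_indices i. rowf ?m (unitf c) * N = rowf ?m (unitf c)"
    unfolding N_def using prod[OF M h(1)] h Suc.prems by auto
  \<comment> \<open>Row i is now e_i, and its pairing with row \<open>n + i\<close>, still equal to
    1, is exactly this entry.\<close>
  have "?row N (n + i) (n + i) = 1"
  proof -
    have "1 = omega n (?row N i) (?row N (n + i))"
      using ortho[OF N, of i "n + i"] i by (simp add: omega_unitf psign_def partner_def)
    also have "\<dots> = omega n (unitf i) (?row N (n + i))"
      using N_fix(1) by (intro omega_cong) (auto simp: rowf_def)
    also have "\<dots> = ?row N (n + i) (n + i)"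
      using i by (subst omega_skew) (simp add: omega_unitf psign_def partner_def add.commute)
    finally show ?thesis by simp
  qed
  moreover have "\<forall>c\<in>low_indices i. ?row N (n + i) c = 0"
  proof
    fix c assume c: "c \<in> low_indices i"
    show "?row N (n + i) c = 0"
      by (rule zero[OF N _ refl]) (use c pc[OF c] N_fix i in \<open>auto simp: low_indices_def\<close>)
  qed
  ultimately obtain h' where h': "h' \<in> K" "rowf ?m (unitf (n + i)) * N * h' = rowf ?m (unitf (n + i))"
    "\<forall>c\<in>insert i (low_indices i). rowf ?m (unitf c) * h' = rowf ?m (unitf c)"
    using reach_unit_partner[OF i, of "?row N (n + i)"] rowf_row[OF N(1)] by (auto simp: reach_def)
  have "low_indices (Suc i) = insert (n + i) (insert i (low_indices i))"
    by (auto simp: low_indices_def)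
  then have "\<exists>g\<in>K. N * h' * g = 1\<^sub>m ?m"
    using prod[OF N h'(1)] h' N_fix Suc.hyps(2) i by (intro Suc.hyps(1)[of "Suc i"]) auto
  then obtain g where g: "g \<in> K" "N * h' * g = 1\<^sub>m ?m" by blast
  have "M * (h * h' * g) = M * (h * h') * g"
    using assoc_mult_mat[OF M(1) K_carrier[OF K_mult[OF h(1) h'(1)]] K_carrier[OF g(1)]] by simp
  also have "M * (h * h') = N * h'"
    unfolding N_def using assoc_mult_mat[OF M(1) K_carrier[OF h(1)] K_carrier[OF h'(1)]] by simp
  finally have "M * (h * h' * g) = 1\<^sub>m ?m" using g(2) by simp
  then show ?case using K_mult[OF K_mult[OF h(1) h'(1)] g(1)] by blast
qed

text \<open>M h = 1 with h in K makes M the inverse of h.\<close>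

theorem symplectic_subset:
  assumes M: "M \<in> carrier_mat (2 * n) (2 * n)" "preserves (symp_form n) M"
  shows "M \<in> K"
proof -
  obtain h where h: "h \<in> K" "M * h = 1\<^sub>m (2 * n)"
    using complete_reduction[OF M, of 0] by (auto simp: low_indices_def)
  obtain g where g: "g \<in> K" "h * g = 1\<^sub>m (2 * n)" using K_inv[OF h(1)] by blast
  have "M = M * (h * g)" using g(2) right_mult_one_mat[OF M(1)] by simp
  also have "\<dots> = M * h * g"
    using assoc_mult_mat[OF M(1) K_carrier[OF h(1)] K_carrier[OF g(1)]] by simp
  also have "\<dots> = g" using h(2) left_mult_one_mat[OF K_carrier[OF g(1)]] by simp
  finally show ?thesis using g(1) by simp
qed

end

section \<open>A chain of transvections in dimension six\<close>

lemma all_less_6: "(\<forall>j<6. P j) \<longleftrightarrow> P 0 \<and> P 1 \<and> P 2 \<and> P 3 \<and> P 4 \<and> P (5 :: nat)"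
  by (auto simp: eval_nat_numeral All_less_Suc)

definition mat6 :: "'a list list \<Rightarrow> 'a mat" where
  "mat6 r = mat 6 6 (\<lambda>(i, j). r ! i ! j)"

lemma mat6_carrier [simp]: "mat6 r \<in> carrier_mat 6 6" "dim_row (mat6 r) = 6" "dim_col (mat6 r) = 6"
  by (simp_all add: mat6_def)

lemma mat6_index: "i < 6 \<Longrightarrow> j < 6 \<Longrightarrow> mat6 r $$ (i, j) = r ! i ! j"
  by (simp add: mat6_def)

lemma sum_6: "sum f {..<6} = f 0 + f 1 + f 2 + f 3 + f 4 + f (5 :: nat)"
  by (simp add: eval_nat_numeral add.assoc)

lemma mat6_mult_index:
  fixes r s :: "'a :: comm_semiring_1 list list"
  shows "i < 6 \<Longrightarrow> j < 6 \<Longrightarrow> (mat6 r * mat6 s) $$ (i, j) = (\<Sum>k<6. r ! i ! k * s ! k ! j)"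
  by (simp add: mat6_def scalar_prod_def lessThan_atLeast0)

lemma mat6_mult_eq:
  fixes r s t :: "'a :: comm_semiring_1 list list"
  assumes "\<forall>i<6. \<forall>j<6. (\<Sum>k<6. r ! i ! k * s ! k ! j) = t ! i ! j"
  shows "mat6 r * mat6 s = mat6 t"
  using assms by (intro eq_matI) (simp_all add: mat6_mult_index mat6_index del: index_mult_mat(1))

text \<open>Makes the sign of a generator harmless when vectors are moved, so that one chain serves
  \<open>gen_mat\<close> and \<open>- gen_mat\<close>.\<close>

lemma transvection_uminus: "dim_col J = dim_col x \<Longrightarrow> transvection J (- x) = transvection J x"
  by (simp add: transvection_def transpose_uminus)

text \<open>Right multiplication by \<open>A\<close> of the second pair, and by \<open>- B\<close> of the first pair, with respect to
  the symplectic bases formed by the rows of the matrices \<open>?P\<close> in the last section.\<close>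

definition gen_mat :: "int mat" where
  "gen_mat = mat6
    [[8, 0, - 3, 2, - 1, 3],
     [- 2, - 3, 5, 1, 4, - 2],
     [11, 5, - 11, 1, - 5, 8],
     [- 27, - 6, 19, - 4, 9, - 14],
     [- 1, - 4, 5, 1, 3, - 3],
     [9, 8, - 15, - 1, - 8, 9]]"

text \<open>Symbolic in the entries, so that each step of the chain is a mere substitution of
  numbers.\<close>

lemma row_gen_mat:
  "rowf 6 ((!) [a, b, c, d, e, f]) * gen_mat = rowf 6 ((!)
    [8 * a - 2 * b + 11 * c - 27 * d - e + 9 * f,
     - 3 * b + 5 * c - 6 * d - 4 * e + 8 * f,
     - 3 * a + 5 * b - 11 * c + 19 * d + 5 * e - 15 * f,
     2 * a + b + c - 4 * d + e - f,
     - a + 4 * b - 5 * c + 9 * d + 3 * e - 8 * f,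
     3 * a - 2 * b + 8 * c - 14 * d - 3 * e + 9 * f])" (is "?l = rowf 6 ((!) ?r)")
proof (rule eq_matI)
  fix i j
  assume "i < dim_row (rowf 6 ((!) ?r))" "j < dim_col (rowf 6 ((!) ?r))"
  then have ij: "i = 0" "j < 6" by (auto simp: rowf_def)
  have "\<forall>j<6. ?l $$ (0, j) = rowf 6 ((!) ?r) $$ (0, j)"
    by (simp add: all_less_6 rowf_def gen_mat_def mat6_def scalar_prod_def
        lessThan_atLeast0[symmetric] sum_6)
  then show "?l $$ (i, j) = rowf 6 ((!) ?r) $$ (i, j)"
    using ij by blast
qed (auto simp: rowf_def gen_mat_def)

text \<open>K stands for a hypergeometric group in symplectic coordinates. One generator up to sign
  and one transvection are enough input for the chain.\<close>

lemma symplectic_transvections_6: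
  assumes "symplectic_subgroup 3 K"
    and X: "gen_mat \<in> K \<or> - gen_mat \<in> K"
    and start: "transvection (symp_form 3) (rowf 6 ((!) [5, 3, -6, 0, -3, 4])) \<in> K"
  shows "symplectic_transvections 3 K"
proof -
  interpret symplectic_subgroup 3 K by fact
  define D where "D l \<longleftrightarrow> transvection (symp_form 3) (rowf 6 ((!) l)) \<in> K" for l
  have X_orbit: "transvection (symp_form 3) (x * gen_mat) \<in> K \<longleftrightarrow> transvection (symp_form 3) x \<in> K"
    if "x \<in> carrier_mat 1 6" for x
  proof (cases "gen_mat \<in> K")
    case True
    then show ?thesis using transvection_orbit[of gen_mat x 1] that by simp
  next
    case False
    have "dim_col x = dim_row gen_mat" "dim_col gen_mat = 6" using that by (auto simp: gen_mat_def)
    then have "transvection (symp_form 3) (x * - gen_mat) = transvection (symp_form 3) (x * gen_mat)"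
      by (simp add: transvection_uminus)
    then show ?thesis using False X transvection_orbit[of "- gen_mat" x 1] that by simp
  qed
  have X_step: "D [8 * a - 2 * b + 11 * c - 27 * d - e + 9 * f,
     - 3 * b + 5 * c - 6 * d - 4 * e + 8 * f,
     - 3 * a + 5 * b - 11 * c + 19 * d + 5 * e - 15 * f,
     2 * a + b + c - 4 * d + e - f,
     - a + 4 * b - 5 * c + 9 * d + 3 * e - 8 * f,
     3 * a - 2 * b + 8 * c - 14 * d - 3 * e + 9 * f]
      \<longleftrightarrow> D [a, b, c, d, e, f]" for a b c d e f
    unfolding D_def row_gen_mat[symmetric] by (rule X_orbit) simp
  \<comment> \<open>\<open>w\<close> is omega(y, x) in dimension six. The equivalence is
    \<open>transvection_orbit\<close> for the transvection along x, an element of K.\<close>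
  have T_step: "D [y0 + w * x0, y1 + w * x1, y2 + w * x2, y3 + w * x3, y4 + w * x4, y5 + w * x5]
      \<longleftrightarrow> D [y0, y1, y2, y3, y4, y5]"
    if x: "D [x0, x1, x2, x3, x4, x5]"
      and "w = y0 * x3 + y1 * x4 + y2 * x5 - y3 * x0 - y4 * x1 - y5 * x2"
    for x0 x1 x2 x3 x4 x5 y0 y1 y2 y3 y4 y5 w
  proof -
    let ?x = "[x0, x1, x2, x3, x4, x5]" and ?y = "[y0, y1, y2, y3, y4, y5]"
    have "omega 3 ((!) ?y) ((!) ?x) = w"
      using that by (simp add: omega_def numeral_eq_Suc algebra_simps)
    then have "rowf 6 ((!) ?y) * transvection (symp_form 3) (rowf 6 ((!) ?x)) = rowf 6 ((!)
       [y0 + w * x0, y1 + w * x1, y2 + w * x2, y3 + w * x3, y4 + w * x4, y5 + w * x5])"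
      using rowf_transvection[of 3 "(!) ?y" "(!) ?x"] by (simp add: rowf_eq_iff all_less_6)
    then show ?thesis
      using transvection_orbit[OF x[unfolded D_def], of "rowf 6 ((!) ?y)" 1] by (simp add: D_def)
  qed
  \<comment> \<open>Needed because most basis vectors are reached only with a minus sign.\<close>
  have neg: "D [- a, - b, - c, - d, - e, - f] \<longleftrightarrow> D [a, b, c, d, e, f]" for a b c d e f
  proof -
    have "rowf 6 ((!) [- a, - b, - c, - d, - e, - f]) = - rowf 6 ((!) [a, b, c, d, e, f])"
      using all_less_6[of "\<lambda>j. [- a, - b, - c, - d, - e, - f] ! j = - ([a, b, c, d, e, f] ! j)"]
      by (auto simp: rowf_def intro!: eq_matI)
    then show ?thesis by (simp add: D_def transvection_uminus rowf_def)
  qed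
  txt \<open>The chain was found by computer search. Where the bracketed vector is the new one, the move is
    applied backwards.\<close>
  have d0: "D [5, 3, - 6, 0, - 3, 4]" using start by (simp add: D_def)
  have d1: "D [7, 5, - 9, 0, - 4, 6]"
    using X_step[of "5" "3" "- 6" "0" "- 3" "4"] d0 by simp
  have d2: "D [5, 4, - 7, 0, - 2, 5]"
    using X_step[of "7" "5" "- 9" "0" "- 4" "6"] d1 by simp
  have d3: "D [2, 1, - 3, 0, 0, 2]"
    using X_step[of "5" "4" "- 7" "0" "- 2" "5"] d2 by simp
  have d4: "D [- 1, - 2, 2, 0, 1, - 2]"
    using X_step[of "2" "1" "- 3" "0" "0" "2"] d3 by simp
  have d5: "D [- 3, 0, 1, - 1, 0, - 1]"
    using X_step[of "- 3" "0" "1" "- 1" "0" "- 1"] d0 by simp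
  have d6: "D [- 10, - 2, 6, - 2, 2, - 5]"
    using X_step[of "- 10" "- 2" "6" "- 2" "2" "- 5"] d5 by simp
  have d7: "D [- 5, 2, - 1, - 2, 0, 0]"
    using T_step[OF d6 refl, of "- 5" "2" "- 1" "- 2" "0" "0"] d2 by simp
  have d8: "D [- 2, 2, - 2, - 1, - 1, 1]"
    using X_step[of "- 2" "2" "- 2" "- 1" "- 1" "1"] d7 by simp
  have d9: "D [- 3, 0, 0, - 1, 0, - 1]"
    using T_step[OF d4 refl, of "- 2" "2" "- 2" "- 1" "- 1" "1"] d8 by simp
  have d10: "D [2, 0, 0, 1, 0, 1]"
    using X_step[of "2" "0" "0" "1" "0" "1"] d8 by simp
  have d11: "D [- 1, 0, 0, 0, 0, 0]"
    using T_step[OF d9 refl, of "2" "0" "0" "1" "0" "1"] d10 by simp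
  have d12: "D [- 8, - 1, 3, - 2, 2, - 3]"
    using T_step[OF d6 refl, of "2" "1" "- 3" "0" "0" "2"] d3 by simp
  have d13: "D [- 3, - 3, 4, 0, 2, - 3]"
    using T_step[OF d7 refl, of "- 8" "- 1" "3" "- 2" "2" "- 3"] d12 by simp
  have d14: "D [15, 6, - 13, 2, - 4, 10]"
    using T_step[OF d6 refl, of "5" "4" "- 7" "0" "- 2" "5"] d2 by simp
  have d15: "D [5, 1, - 4, 1, 0, 3]"
    using X_step[of "15" "6" "- 13" "2" "- 4" "10"] d14 by simp
  have d16: "D [- 6, - 5, 8, 0, 4, - 6]"
    using X_step[of "5" "1" "- 4" "1" "0" "3"] d15 by simp
  have d17: "D [0, 1, 0, 0, 0, 0]"
    using T_step[OF d13 refl, of "0" "1" "0" "0" "0" "0"] d16 by simp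
  have d18: "D [0, 0, - 1, 0, 0, 0]"
    using T_step[OF d5 refl, of "0" "0" "- 1" "0" "0" "0"] d9 by simp
  have d19: "D [- 4, 4, - 4, - 3, - 2, 2]"
    using T_step[OF d5 refl, of "- 4" "4" "- 4" "- 3" "- 2" "2"] d2 by simp
  have d20: "D [0, 0, 0, - 1, 0, 0]"
    using T_step[OF d8 refl, of "- 4" "4" "- 4" "- 3" "- 2" "2"] d19 by simp
  have d21: "D [- 9, - 3, 7, - 1, 3, - 5]"
    using X_step[of "- 9" "- 3" "7" "- 1" "3" "- 5"] d6 by simp
  have d22: "D [1, 2, - 4, - 1, - 1, 2]"
    using T_step[OF d21 refl, of "- 8" "- 1" "3" "- 2" "2" "- 3"] d12 by simp
  have d23: "D [- 3, - 3, 6, 1, 3, - 3]"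
    using X_step[of "- 3" "- 3" "6" "1" "3" "- 3"] d21 by simp
  have d24: "D [- 1, 1, - 2, - 1, 0, 1]"
    using X_step[of "- 5" "2" "- 1" "- 2" "0" "0"] d7 by simp
  have d25: "D [2, 4, - 8, - 2, - 3, 4]"
    using T_step[OF d23 refl, of "- 1" "1" "- 2" "- 1" "0" "1"] d24 by simp
  have d26: "D [0, 0, 0, 0, - 1, 0]"
    using T_step[OF d22 refl, of "0" "0" "0" "0" "- 1" "0"] d25 by simp
  have d27: "D [0, 6, - 8, - 2, - 2, 5]"
    using T_step[OF d2 refl, of "- 5" "2" "- 1" "- 2" "0" "0"] d7 by simp
  have d28: "D [2, 4, - 4, 0, - 2, 3]"
    using T_step[OF d24 refl, of "2" "4" "- 4" "0" "- 2" "3"] d27 by simp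
  have d29: "D [0, 0, 0, 0, 0, - 1]"
    using T_step[OF d4 refl, of "2" "4" "- 4" "0" "- 2" "3"] d28 by simp
  \<comment> \<open>All six basis vectors are now reached up to sign. The remaining moves lead to
    the twelve sums of two basis vectors that are not partners.\<close>
  have d30: "D [- 5, 2, - 1, - 2, 0, - 1]"
    using T_step[OF d7 refl, of "- 5" "2" "- 1" "- 2" "0" "- 1"] d29 by simp
  have d31: "D [4, 0, 0, 1, 0, 2]"
    using T_step[OF d10 refl, of "0" "0" "0" "- 1" "0" "0"] d20 by simp
  have d32: "D [5, - 1, 2, 2, 0, 1]"
    using T_step[OF d24 refl, of "5" "- 1" "2" "2" "0" "1"] d31 by simp
  have d33: "D [0, 1, 1, 0, 0, 0]"
    using T_step[OF d30 refl, of "0" "1" "1" "0" "0" "0"] d32 by simp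
  have d34: "D [- 2, 1, 1, - 1, 0, - 1]"
    using T_step[OF d10 refl, of "- 2" "1" "1" "- 1" "0" "- 1"] d33 by simp
  have d35: "D [1, 1, 0, 0, 0, 0]"
    using T_step[OF d5 refl, of "- 2" "1" "1" "- 1" "0" "- 1"] d34 by simp
  have d36: "D [1, 0, 0, 0, 0, 1]"
    using T_step[OF d9 refl, of "1" "0" "0" "0" "0" "1"] d31 by simp
  have d37: "D [1, 0, 1, 0, 0, 1]"
    using T_step[OF d18 refl, of "1" "0" "1" "0" "0" "1"] d36 by simp
  have d38: "D [1, 0, 1, 0, 0, 0]"
    using T_step[OF d29 refl, of "1" "0" "1" "0" "0" "0"] d37 by simp
  \<comment> \<open>From here to \<open>d48\<close> the moves come in pairs that replace one member
    of a sum by its partner: the transvection along the partner adds it, and the one along the old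
    member then removes that member.\<close>
  have d39: "D [1, 1, 0, 1, 0, 0]"
    using T_step[OF d20 refl, of "1" "1" "0" "0" "0" "0"] d35 by simp
  have d40: "D [0, 1, 0, 1, 0, 0]"
    using T_step[OF d11 refl, of "1" "1" "0" "1" "0" "0"] d39 by simp
  have d41: "D [1, 0, 1, 1, 0, 0]"
    using T_step[OF d20 refl, of "1" "0" "1" "0" "0" "0"] d38 by simp
  have d42: "D [0, 0, 1, 1, 0, 0]"
    using T_step[OF d11 refl, of "1" "0" "1" "1" "0" "0"] d41 by simp
  have d43: "D [1, 1, 0, 0, 1, 0]"
    using T_step[OF d26 refl, of "1" "1" "0" "0" "0" "0"] d35 by simp
  have d44: "D [1, 0, 0, 0, 1, 0]"
    using T_step[OF d17 refl, of "1" "1" "0" "0" "1" "0"] d43 by simp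
  have d45: "D [0, 1, 1, 0, 1, 0]"
    using T_step[OF d26 refl, of "0" "1" "1" "0" "0" "0"] d33 by simp
  have d46: "D [0, 0, 1, 0, 1, 0]"
    using T_step[OF d17 refl, of "0" "1" "1" "0" "1" "0"] d45 by simp
  have d47: "D [0, 1, 0, 1, 1, 0]"
    using T_step[OF d26 refl, of "0" "1" "0" "1" "0" "0"] d40 by simp
  have d48: "D [0, 0, 0, 1, 1, 0]"
    using T_step[OF d17 refl, of "0" "1" "0" "1" "1" "0"] d47 by simp
  have d49: "D [5, - 1, 1, 2, 0, 1]"
    using T_step[OF d18 refl, of "5" "- 1" "2" "2" "0" "1"] d32 by simp
  have d50: "D [0, 1, 0, 0, 0, 1]"
    using T_step[OF d7 refl, of "5" "- 1" "1" "2" "0" "1"] d49 by simp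
  have d51: "D [1, 0, 0, 1, 0, 1]"
    using T_step[OF d11 refl, of "2" "0" "0" "1" "0" "1"] d10 by simp
  have d52: "D [0, 0, 0, 1, 0, 1]"
    using T_step[OF d11 refl, of "1" "0" "0" "1" "0" "1"] d51 by simp
  have d53: "D [0, 1, 0, 0, 1, 1]"
    using T_step[OF d26 refl, of "0" "1" "0" "0" "0" "1"] d50 by simp
  have d54: "D [0, 0, 0, 0, 1, 1]"
    using T_step[OF d17 refl, of "0" "1" "0" "0" "1" "1"] d53 by simp
  have D_eq: "transvection (symp_form 3) (rowf 6 v) \<in> K \<longleftrightarrow> D [v 0, v 1, v 2, v 3, v 4, v 5]" for v
  proof -
    have "rowf 6 v = rowf 6 ((!) [v 0, v 1, v 2, v 3, v 4, v 5])"
      by (simp add: rowf_eq_iff all_less_6)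
    then show ?thesis by (simp add: D_def)
  qed
  have unit: "\<forall>c<6. transvection (symp_form 3) (rowf 6 (unitf c)) \<in> K"
    unfolding all_less_6 D_eq
    using d11 d17 d18 d20 d26 d29 neg[of 1 0 0 0 0 0] neg[of 0 0 1 0 0 0] neg[of 0 0 0 1 0 0]
      neg[of 0 0 0 0 1 0] neg[of 0 0 0 0 0 1]
    by simp
  have sum: "\<forall>c<6. \<forall>d<6. d \<noteq> c \<longrightarrow> d \<noteq> partner 3 c \<longrightarrow>
      transvection (symp_form 3) (rowf 6 (\<lambda>j. unitf c j + unitf d j)) \<in> K"
    unfolding all_less_6 D_eq
    using d35 d38 d33 d40 d42 d44 d46 d48 d36 d50 d52 d54
    by (simp add: partner_def)
  show ?thesis
    by unfold_locales (use unit sum in auto)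
qed

section \<open>Hypergeometric groups and their invariant forms\<close>

lemma preserves_inverse:
  assumes c: "J \<in> carrier_mat m m" "h \<in> carrier_mat m m" "g \<in> carrier_mat m m"
    and gh: "g * h = 1\<^sub>m m" and p: "preserves J h"
  shows "preserves J g"
proof -
  have t: "h\<^sup>T \<in> carrier_mat m m" "g\<^sup>T \<in> carrier_mat m m" using c by auto
  have "h\<^sup>T * g\<^sup>T = 1\<^sub>m m" using gh transpose_mult[OF c(3,2)] by simp
  then have "J = g * h * J * (h\<^sup>T * g\<^sup>T)" using c gh by simp
  also have "\<dots> = g * (h * J * h\<^sup>T) * g\<^sup>T"
    using c t by (simp add: assoc_mult_mat[of _ m m _ m _ m])
  finally show ?thesis using p by (simp add: preserves_def)
qed

lemma GL_int_group: "group (GL_int n)"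
  unfolding GL_int_def by (rule monoid.units_group[OF ring.is_monoid[OF ring_mat]])

lemma GL_int_simps [simp]:
  "monoid.mult (GL_int n) = (*)" "monoid.one (GL_int n) = 1\<^sub>m n"
  by (simp_all add: GL_int_def units_of_def ring_mat_simps)

lemma GL_int_carrier_iff:
  "h \<in> carrier (GL_int n) \<longleftrightarrow>
     h \<in> carrier_mat n n \<and> (\<exists>g\<in>carrier_mat n n. g * h = 1\<^sub>m n \<and> h * g = 1\<^sub>m n)"
  by (auto simp: GL_int_def units_of_def Units_def ring_mat_simps)

lemma preserves_form_iff:
  assumes c: "J \<in> carrier_mat n n" "h \<in> carrier_mat n n"
  shows "preserves_form (map_mat rat_of_int J) h \<longleftrightarrow> preserves J h"
proof -
  have t: "h\<^sup>T \<in> carrier_mat n n" "h * J \<in> carrier_mat n n" using c by auto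
  have "map_mat rat_of_int h * map_mat rat_of_int J * (map_mat rat_of_int h)\<^sup>T
      = map_mat rat_of_int (h * J * h\<^sup>T)"
    using of_int_hom.mat_hom_mult[OF c(2,1), where 'a = rat]
      of_int_hom.mat_hom_mult[OF t(2,1), where 'a = rat] by (simp add: map_mat_transpose)
  then show ?thesis
    using of_int_hom.mat_hom_inj[where 'a = rat] by (auto simp: preserves_form_def preserves_def)
qed

lemma preserves_form_smult:
  assumes "c \<noteq> 0" "M \<in> carrier_mat n n" "h \<in> carrier_mat n n"
  shows "preserves_form (c \<cdot>\<^sub>m M) h \<longleftrightarrow> preserves_form M h"
proof -
  let ?h = "map_mat rat_of_int h"
  have h: "?h \<in> carrier_mat n n" "?h\<^sup>T \<in> carrier_mat n n" using assms by auto
  have "?h * (c \<cdot>\<^sub>m M) * ?h\<^sup>T = c \<cdot>\<^sub>m (?h * M * ?h\<^sup>T)"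
    using mult_smult_distrib[OF h(1) assms(2)] mult_smult_assoc_mat[OF mult_carrier_mat[OF h(1) assms(2)] h(2)]
    by simp
  moreover have "c \<cdot>\<^sub>m X = c \<cdot>\<^sub>m Y \<longleftrightarrow> X = Y" for X Y :: "rat mat"
    using assms(1) by (auto simp: mat_eq_iff)
  ultimately show ?thesis by (simp add: preserves_form_def)
qed

lemma hypergeometric_subgroup:
  assumes "degree g = degree f"
    and "companion f \<in> carrier (GL_int (degree f))" "companion g \<in> carrier (GL_int (degree f))"
  shows "subgroup (hypergeometric_group f g) (GL_int (degree f))"
    and "companion f \<in> hypergeometric_group f g" "companion g \<in> hypergeometric_group f g"
proof -
  interpret G: group "GL_int (degree f)" by (rule GL_int_group)
  let ?S = "{companion f, inv\<^bsub>GL_int (degree f)\<^esub> (companion g)}"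
  have S: "?S \<subseteq> carrier (GL_int (degree f))" using assms by auto
  show sub: "subgroup (hypergeometric_group f g) (GL_int (degree f))"
    unfolding hypergeometric_group_def by (rule G.generate_is_subgroup[OF S])
  show "companion f \<in> hypergeometric_group f g"
    unfolding hypergeometric_group_def by (rule generate.incl) simp
  have "inv\<^bsub>GL_int (degree f)\<^esub> (companion g) \<in> hypergeometric_group f g"
    unfolding hypergeometric_group_def by (rule generate.incl) simp
  then show "companion g \<in> hypergeometric_group f g"
    using subgroup.m_inv_closed[OF sub] G.inv_inv[OF assms(3)] by fastforce
qed

lemma subgroup_matrix_subgroup:
  assumes "subgroup H (GL_int n)"
  shows "matrix_subgroup n H"
proof
  interpret G: group "GL_int n" by (rule GL_int_group)
  interpret subgroup H "GL_int n" by fact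
  show "h \<in> carrier_mat n n" if "h \<in> H" for h
    using mem_carrier[OF that] by (simp add: GL_int_carrier_iff)
  show "1\<^sub>m n \<in> H" using one_closed by simp
  show "g * h \<in> H" if "g \<in> H" "h \<in> H" for g h using m_closed[OF that] by simp
  show "\<exists>g\<in>H. h * g = 1\<^sub>m n \<and> g * h = 1\<^sub>m n" if "h \<in> H" for h
    using m_inv_closed[OF that] G.r_inv[OF mem_carrier[OF that]] G.l_inv[OF mem_carrier[OF that]] by auto
qed

lemma hypergeometric_group_preserves:
  assumes f: "degree g = degree f"
    "companion f \<in> carrier (GL_int (degree f))" "companion g \<in> carrier (GL_int (degree f))"
    and J: "J \<in> carrier_mat (degree f) (degree f)" "preserves J (companion f)" "preserves J (companion g)"
    and h: "h \<in> hypergeometric_group f g"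
  shows "preserves J h"
proof -
  interpret G: group "GL_int (degree f)" by (rule GL_int_group)
  let ?n = "degree f" and ?S = "{companion f, inv\<^bsub>GL_int (degree f)\<^esub> (companion g)}"
  have inv_pres: "preserves J (inv\<^bsub>GL_int ?n\<^esub> k)"
    if "k \<in> carrier (GL_int ?n)" "preserves J k" for k
    using preserves_inverse[OF J(1) _ _ _ that(2), of "inv\<^bsub>GL_int ?n\<^esub> k"] that(1)
      G.inv_closed[OF that(1)] G.l_inv[OF that(1)]
    by (simp add: GL_int_carrier_iff)
  have S: "?S \<subseteq> carrier (GL_int ?n)" using f by auto
  have "h \<in> generate (GL_int ?n) ?S" using h by (simp add: hypergeometric_group_def)
  then show ?thesis
  proof induction
    case one
    show ?case using J(1) by (simp add: preserves_def)
  next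
    case (incl h)
    then show ?case using J inv_pres[OF f(3)] by auto
  next
    case (inv h)
    have "inv\<^bsub>GL_int ?n\<^esub> (inv\<^bsub>GL_int ?n\<^esub> companion g) = companion g"
      by (rule G.inv_inv[OF f(3)])
    then show ?case using inv.hyps J inv_pres[OF f(2)] by auto
  next
    case (eng h1 h2)
    have "h1 \<in> carrier_mat ?n ?n" "h2 \<in> carrier_mat ?n ?n"
      using eng G.generate_in_carrier[OF S] by (auto simp: GL_int_carrier_iff)
    then show ?case using preserves_mult[OF J(1)] eng by simp
  qed
qed

lemma finite_index_self:
  assumes "group G" "subgroup H G" "carrier G = H"
  shows "finite_index_subgroup H G"
proof -
  interpret group G by fact
  have "rcosets\<^bsub>G\<^esub> H \<subseteq> {H}"
    using coset_join2[OF _ assms(2)] assms(3) by (auto simp: RCOSETS_def)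
  then show ?thesis
    using assms(2) finite_subset by (auto simp: finite_index_subgroup_def)
qed

section \<open>Uniqueness of the invariant form\<close>

text \<open>Row k of the companion matrix C is e_(k-1) minus \<open>coeff f k\<close> times the last
  unit vector, with e_(-1) read as 0. Expanding C \<Phi> C^T = \<Phi> gives four terms, and the one
  with \<open>coeff f i * coeff f j\<close> vanishes because a skew form has zero diagonal. So the
  last column, recorded by \<open>z\<close> with a shift by one, determines the form.\<close>

lemma companion_form_recursion:
  fixes \<Phi> :: "rat mat"
  defines "z \<equiv> \<lambda>f i. if i = 0 then 0 else \<Phi> $$ (i - 1, degree (f :: int poly) - 1)"
  assumes \<Phi>: "\<Phi> \<in> carrier_mat (degree f) (degree f)" "\<Phi>\<^sup>T = - \<Phi>"
    and inv: "preserves_form \<Phi> (companion f)" and i: "i < degree f" and j: "j < degree f"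
  shows "\<Phi> $$ (i, j) = (if i = 0 \<or> j = 0 then 0 else \<Phi> $$ (i - 1, j - 1))
    + of_int (coeff f i) * z f j - of_int (coeff f j) * z f i"
proof -
  let ?n = "degree f" and ?C = "map_mat rat_of_int (companion f)"
  have skew: "\<Phi> $$ (k, l) = - \<Phi> $$ (l, k)" if "k < ?n" "l < ?n" for k l
    using arg_cong[OF \<Phi>(2), of "\<lambda>M. M $$ (l, k)"] \<Phi>(1) that by simp
  have diag: "\<Phi> $$ (k, k) = 0" if "k < ?n" for k using skew[OF that that] by simp
  have C: "?C \<in> carrier_mat ?n ?n" by (simp add: companion_def)
  have pos: "?n - 1 < ?n" using i by simp
  have row: "(\<Sum>l<?n. ?C $$ (k, l) * x l) = (if k = 0 then 0 else x (k - 1)) - of_int (coeff f k) * x (?n - 1)"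
    if k: "k < ?n" for k and x :: "nat \<Rightarrow> rat"
  proof -
    have "(\<Sum>l<?n. ?C $$ (k, l) * x l)
        = (\<Sum>l<?n. (if l = ?n - 1 then - of_int (coeff f k) * x l else 0) + (if k \<noteq> 0 \<and> l = k - 1 then x l else 0))"
      using k by (intro sum.cong) (auto simp: companion_def)
    also have "\<dots> = - of_int (coeff f k) * x (?n - 1) + (\<Sum>l<?n. if k \<noteq> 0 \<and> l = k - 1 then x l else 0)"
      using pos by (simp add: sum.distrib)
    also have "(\<Sum>l<?n. if k \<noteq> 0 \<and> l = k - 1 then x l else 0) = (if k = 0 then 0 else x (k - 1))"
      using k by (cases "k = 0") auto
    finally show ?thesis by simp
  qed
  have C\<Phi>: "?C * \<Phi> \<in> carrier_mat ?n ?n" by (rule mult_carrier_mat[OF C \<Phi>(1)])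
  have mult_transpose: "(X * ?C\<^sup>T) $$ (i, j) = (\<Sum>k<?n. ?C $$ (j, k) * X $$ (i, k))"
    if "X \<in> carrier_mat ?n ?n" for X
    using that C i j by (simp add: scalar_prod_def lessThan_atLeast0 mult.commute)
  have left: "(?C * \<Phi>) $$ (i, k) = (if i = 0 then 0 else \<Phi> $$ (i - 1, k)) - of_int (coeff f i) * \<Phi> $$ (?n - 1, k)"
    if k: "k < ?n" for k
  proof -
    have "(?C * \<Phi>) $$ (i, k) = (\<Sum>l<?n. ?C $$ (i, l) * \<Phi> $$ (l, k))"
      using \<Phi>(1) C i k by (simp add: scalar_prod_def lessThan_atLeast0)
    then show ?thesis using row[OF i, of "\<lambda>l. \<Phi> $$ (l, k)"] by simp
  qed
  have "\<Phi> $$ (i, j) = (?C * \<Phi> * ?C\<^sup>T) $$ (i, j)"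
    using inv by (simp add: preserves_form_def)
  also have "\<dots> = (\<Sum>k<?n. ?C $$ (j, k) * (?C * \<Phi>) $$ (i, k))"
    by (rule mult_transpose[OF C\<Phi>])
  also have "\<dots> = (if j = 0 then 0 else (?C * \<Phi>) $$ (i, j - 1)) - of_int (coeff f j) * (?C * \<Phi>) $$ (i, ?n - 1)"
    by (rule row[OF j])
  also have "\<dots> = (if i = 0 \<or> j = 0 then 0 else \<Phi> $$ (i - 1, j - 1))
    + of_int (coeff f i) * z f j - of_int (coeff f j) * z f i"
    using skew[of "?n - 1" "j - 1"] diag[OF pos] i j pos
    by (simp add: left z_def del: index_mult_mat(1))
  finally show ?thesis .
qed

lemma companion_form_eq_0:
  fixes \<Phi> :: "rat mat"
  assumes \<Phi>: "\<Phi> \<in> carrier_mat (degree f) (degree f)" "\<Phi>\<^sup>T = - \<Phi>"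
    and inv: "preserves_form \<Phi> (companion f)"
    and z: "\<And>i. 0 < i \<Longrightarrow> i < degree f \<Longrightarrow> \<Phi> $$ (i - 1, degree f - 1) = 0"
  shows "\<Phi> = 0\<^sub>m (degree f) (degree f)"
proof -
  have "\<Phi> $$ (i, j) = 0" if "i < degree f" "j < degree f" for i j
    using that
  proof (induction i arbitrary: j)
    case 0
    then show ?case using companion_form_recursion[OF \<Phi> inv 0] z[of j] by simp
  next
    case (Suc i)
    then show ?case using companion_form_recursion[OF \<Phi> inv Suc.prems] z[of j] z[of "Suc i"] by simp
  qed
  then show ?thesis using \<Phi>(1) by (intro eq_matI) auto
qed

text \<open>The recursions for f and g share the shifted entry, so their difference makes the
  shifted last column proportional to the vector \<open>\<gamma>\<close> of coefficient differences.
  One scalar remains free, and the recursion spreads it to all entries.\<close>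

lemma companion_form_unique:
  fixes \<Phi> \<Psi> :: "rat mat"
  assumes g: "degree g = degree f" and neq: "\<exists>i<degree f. coeff f i \<noteq> coeff g i"
    and \<Psi>: "\<Psi> \<in> carrier_mat (degree f) (degree f)" "\<Psi>\<^sup>T = - \<Psi>"
      "preserves_form \<Psi> (companion f)" "preserves_form \<Psi> (companion g)"
      "\<Psi> \<noteq> 0\<^sub>m (degree f) (degree f)"
    and \<Phi>: "\<Phi> \<in> carrier_mat (degree f) (degree f)" "\<Phi>\<^sup>T = - \<Phi>"
      "preserves_form \<Phi> (companion f)" "preserves_form \<Phi> (companion g)"
  shows "\<exists>c. \<Phi> = c \<cdot>\<^sub>m \<Psi>"
proof -
  let ?n = "degree f"
  define \<gamma> where "\<gamma> i = rat_of_int (coeff f i) - rat_of_int (coeff g i)" for i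
  define z where "z \<Phi> i = (if i = 0 then 0 else \<Phi> $$ (i - 1, ?n - 1))" for \<Phi> :: "rat mat" and i
  have proportional: "\<gamma> i * z \<Phi> j = \<gamma> j * z \<Phi> i"
    if "\<Phi> \<in> carrier_mat ?n ?n" "\<Phi>\<^sup>T = - \<Phi>" "preserves_form \<Phi> (companion f)" "preserves_form \<Phi> (companion g)"
      "i < ?n" "j < ?n" for \<Phi> i j
  proof -
    let ?b = "if i = 0 \<or> j = 0 then 0 else \<Phi> $$ (i - 1, j - 1)"
    have "\<Phi> $$ (i, j) = ?b + of_int (coeff f i) * z \<Phi> j - of_int (coeff f j) * z \<Phi> i"
      unfolding z_def by (rule companion_form_recursion[OF that(1,2,3,5,6)])
    moreover have "\<Phi> $$ (i, j) = ?b + of_int (coeff g i) * z \<Phi> j - of_int (coeff g j) * z \<Phi> i"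
      unfolding z_def by (rule companion_form_recursion[of \<Phi> g i j, unfolded g, OF that(1,2,4,5,6)])
    ultimately show ?thesis by (simp add: \<gamma>_def algebra_simps)
  qed
  obtain k where k: "0 < k" "k < ?n" "\<Psi> $$ (k - 1, ?n - 1) \<noteq> 0"
    using companion_form_eq_0[OF \<Psi>(1-3)] \<Psi>(5) by blast
  obtain i where i: "i < ?n" "\<gamma> i \<noteq> 0" using neq by (auto simp: \<gamma>_def)
  \<comment> \<open>In \<open>\<gamma> i * z \<Psi> k = \<gamma> k * z \<Psi> i\<close> both factors
    on the left are nonzero.\<close>
  have "\<gamma> k \<noteq> 0" using proportional[OF \<Psi>(1-4) i(1) k(2)] i(2) k by (auto simp: z_def)
  define c where "c = z \<Phi> k / z \<Psi> k"
  have zk: "z \<Psi> k \<noteq> 0" using k by (simp add: z_def)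
  have form: "\<Phi> $$ (i, j) = c * \<Psi> $$ (i, j)" if ij: "i < ?n" "j < ?n" for i j
  proof -
    have z_eq: "z \<Phi> l = c * z \<Psi> l" if "l < ?n" for l
    proof -
      have "\<gamma> k * (z \<Phi> l * z \<Psi> k) = (\<gamma> k * z \<Phi> l) * z \<Psi> k" by simp
      also have "\<dots> = \<gamma> l * z \<Psi> k * z \<Phi> k" using proportional[OF \<Phi>(1-4) that k(2)] by simp
      also have "\<dots> = \<gamma> k * (z \<Phi> k * z \<Psi> l)" using proportional[OF \<Psi>(1-4) that k(2)] by simp
      finally have "z \<Phi> l * z \<Psi> k = z \<Phi> k * z \<Psi> l" using \<open>\<gamma> k \<noteq> 0\<close> by simp
      then show ?thesis using zk by (simp add: c_def field_simps)
    qed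
    show ?thesis using ij
    proof (induction i arbitrary: j)
      case 0
      then show ?case
        using companion_form_recursion[OF \<Phi>(1-3) 0] companion_form_recursion[OF \<Psi>(1-3) 0] z_eq[of j] z_eq[of 0]
        by (simp add: z_def)
    next
      case (Suc i)
      have "\<Phi> $$ (i, j - 1) = c * \<Psi> $$ (i, j - 1)" using Suc by simp
      then show ?case
        using companion_form_recursion[OF \<Phi>(1-3) Suc.prems] companion_form_recursion[OF \<Psi>(1-3) Suc.prems]
          z_eq[OF Suc.prems(1)] z_eq[OF Suc.prems(2)]
        by (cases "j = 0") (simp_all add: z_def right_diff_distrib distrib_left mult.left_commute)
    qed
  qed
  show ?thesis using \<Phi>(1) \<Psi>(1) form by (intro exI[of _ c] eq_matI) auto
qed

text \<open>By uniqueness every invariant form is a nonzero multiple of J and has the same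
  stabiliser. It is therefore enough that the group is the whole stabiliser of one integral
  form.\<close>

lemma arithmetic_hypergeometricI:
  fixes f g :: "int poly" and J :: "int mat"
  assumes f: "degree g = degree f"
    "companion f \<in> carrier (GL_int (degree f))" "companion g \<in> carrier (GL_int (degree f))"
    and pos: "degree f > 0"
    and J: "J \<in> carrier_mat (degree f) (degree f)" "J\<^sup>T = - J" "det J \<noteq> 0"
      "preserves J (companion f)" "preserves J (companion g)"
    and neq: "\<exists>i<degree f. coeff f i \<noteq> coeff g i"
    and full: "\<And>h. h \<in> carrier_mat (degree f) (degree f) \<Longrightarrow> preserves J h \<Longrightarrow> h \<in> hypergeometric_group f g"
  shows "arithmetic_hypergeometric f g"
proof -
  let ?n = "degree f" and ?H = "hypergeometric_group f g" and ?J = "map_mat rat_of_int J"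
  note sub = hypergeometric_subgroup[OF f]
  interpret G: group "GL_int ?n" by (rule GL_int_group)
  have carr: "h \<in> carrier_mat ?n ?n" if "h \<in> ?H" for h
    using subgroup.mem_carrier[OF sub(1) that] by (simp add: GL_int_carrier_iff)
  have Jc: "?J \<in> carrier_mat ?n ?n" using J(1) by simp
  have skew: "J $$ (j, i) = - J $$ (i, j)" if "i < ?n" "j < ?n" for i j
    using arg_cong[OF J(2), of "\<lambda>M. M $$ (i, j)"] J(1) that by simp
  have "?J\<^sup>T = - ?J"
  proof (rule eq_matI)
    fix i j assume "i < dim_row (- ?J)" "j < dim_col (- ?J)"
    then have "i < ?n" "j < ?n" using J(1) by auto
    then show "?J\<^sup>T $$ (i, j) = (- ?J) $$ (i, j)" using J(1) arg_cong[OF skew[of i j], of rat_of_int] by simp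
  qed (use J(1) in auto)
  moreover have "det ?J = rat_of_int (det J)" by (rule of_int_hom.hom_det)
  then have det_J: "det ?J \<noteq> 0" using J(3) by simp
  ultimately have inv_J: "invariant_symplectic_form f g ?J"
    using Jc hypergeometric_group_preserves[OF f J(1,4,5)] preserves_form_iff[OF J(1)] carr
    by (auto simp: invariant_symplectic_form_def symplectic_form_def)
  have unique: "\<exists>c. \<Phi> = c \<cdot>\<^sub>m ?J"
    if "\<Phi> \<in> carrier_mat ?n ?n" "\<Phi>\<^sup>T = - \<Phi>" "preserves_form \<Phi> (companion f)" "preserves_form \<Phi> (companion g)"
    for \<Phi>
  proof (rule companion_form_unique[OF f(1) neq Jc _ _ _ _ that])
    show "?J\<^sup>T = - ?J" using inv_J by (simp add: invariant_symplectic_form_def symplectic_form_def)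
    show "preserves_form ?J (companion f)" "preserves_form ?J (companion g)"
      using inv_J sub by (simp_all add: invariant_symplectic_form_def)
    show "?J \<noteq> 0\<^sub>m ?n ?n"
      using det_J pos det_zero[of ?n] by metis
  qed
  have "finite_index_subgroup ?H ((GL_int ?n)\<lparr>carrier := Sp_int ?n \<Phi>\<rparr>)"
    if inv: "invariant_symplectic_form f g \<Phi>" for \<Phi>
  proof -
    have \<Phi>: "\<Phi> \<in> carrier_mat ?n ?n" "\<Phi>\<^sup>T = - \<Phi>" "det \<Phi> \<noteq> 0"
      "\<And>h. h \<in> ?H \<Longrightarrow> preserves_form \<Phi> h"
      using inv by (auto simp: invariant_symplectic_form_def symplectic_form_def)
    obtain c where c: "\<Phi> = c \<cdot>\<^sub>m ?J" using unique[OF \<Phi>(1,2)] \<Phi>(4) sub by blast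
    have "c \<noteq> 0"
    proof
      assume "c = 0"
      then have "det \<Phi> = 0" using c pos J(1) by (simp add: det_smult)
      then show False using \<Phi>(3) by simp
    qed
    then have "preserves_form \<Phi> h \<longleftrightarrow> preserves J h" if "h \<in> carrier_mat ?n ?n" for h
      using preserves_form_smult[OF _ Jc that] preserves_form_iff[OF J(1) that] c by simp
    then have "Sp_int ?n \<Phi> = ?H"
      using full subgroup.mem_carrier[OF sub(1)] \<Phi>(4) by (auto simp: Sp_int_def GL_int_carrier_iff)
    then show ?thesis
      using subgroup.subgroup_is_group[OF sub(1) GL_int_group]
        group.subgroup_self[of "(GL_int ?n)\<lparr>carrier := ?H\<rparr>"]
      by (intro finite_index_self) simp_all
  qed
  then show ?thesis using inv_J unfolding arithmetic_hypergeometric_def by blast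
qed

section \<open>Change of basis\<close>

text \<open>Q P = 1 and P J P^T = J' give Q J' = J P^T, which brings Q J' x^T x P into the form J (x
  P)^T (x P). The rows of P are the new basis, and x holds coordinates in it.\<close>

lemma transvection_base_change:
  assumes c: "P \<in> carrier_mat m m" "Q \<in> carrier_mat m m" "J \<in> carrier_mat m m" "x \<in> carrier_mat k m"
    and QP: "Q * P = 1\<^sub>m m" and J': "P * J * P\<^sup>T = J'"
  shows "Q * transvection J' x * P = transvection J (x * P)"
proof -
  have t: "P\<^sup>T \<in> carrier_mat m m" "x\<^sup>T \<in> carrier_mat m k" "x * P \<in> carrier_mat k m"
    "J' \<in> carrier_mat m m" "J * P\<^sup>T \<in> carrier_mat m m"
    using c J' by auto
  have Jx: "J' * x\<^sup>T \<in> carrier_mat m k" by (rule mult_carrier_mat[OF t(4,2)])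
  have Jxx: "J' * x\<^sup>T * x \<in> carrier_mat m m" by (rule mult_carrier_mat[OF Jx c(4)])
  have "Q * J' = (Q * P) * (J * P\<^sup>T)"
    using c t by (simp add: J'[symmetric] assoc_mult_mat[of _ m m _ m _ m])
  then have QJ: "Q * J' = J * P\<^sup>T" using QP left_mult_one_mat[OF t(5)] by simp
  have "Q * transvection J' x * P = (Q * 1\<^sub>m m + Q * (J' * x\<^sup>T * x)) * P"
    using mult_add_distrib_mat[OF c(2) one_carrier_mat Jxx] t(4) by (simp add: transvection_def)
  also have "\<dots> = 1\<^sub>m m + Q * (J' * x\<^sup>T * x) * P"
    using add_mult_distrib_mat[OF _ mult_carrier_mat[OF c(2) Jxx] c(1), of Q] c QP by simp
  also have "Q * (J' * x\<^sup>T * x) = Q * (J' * x\<^sup>T) * x"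
    by (rule assoc_mult_mat[OF c(2) Jx c(4), symmetric])
  also have "Q * (J' * x\<^sup>T) = J * P\<^sup>T * x\<^sup>T"
    using assoc_mult_mat[OF c(2) t(4,2)] QJ by simp
  also have "\<dots> = J * (x * P)\<^sup>T"
    using assoc_mult_mat[OF c(3) t(1,2)] transpose_mult[OF c(4,1)] by simp
  also have "J * (x * P)\<^sup>T * x * P = J * (x * P)\<^sup>T * (x * P)"
    using c t by (intro assoc_mult_mat[of _ m k]) auto
  finally show ?thesis using c by (simp add: transvection_def)
qed

lemma preserves_base_change:
  assumes c: "P \<in> carrier_mat m m" "Q \<in> carrier_mat m m" "J \<in> carrier_mat m m" "h \<in> carrier_mat m m"
    and QP: "Q * P = 1\<^sub>m m" and J': "P * J * P\<^sup>T = J'" and h: "preserves J h"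
  shows "preserves J' (P * h * Q)"
proof -
  have t: "P\<^sup>T \<in> carrier_mat m m" "Q\<^sup>T \<in> carrier_mat m m" "h\<^sup>T \<in> carrier_mat m m"
    using c by auto
  have QP': "P\<^sup>T * Q\<^sup>T = 1\<^sub>m m" using transpose_mult[OF c(2,1)] QP by simp
  have "P * h * Q * J' * (P * h * Q)\<^sup>T = P * (h * ((Q * P) * J * (P\<^sup>T * Q\<^sup>T)) * h\<^sup>T) * P\<^sup>T"
    using c t by (simp add: J'[symmetric] assoc_mult_mat[of _ m m _ m _ m] transpose_mult[of _ m m _ m])
  also have "\<dots> = P * (h * J * h\<^sup>T) * P\<^sup>T" using c QP QP' by simp
  finally show ?thesis using h J' by (simp add: preserves_def)
qed

text \<open>The set \<open>K\<close> of the proof is H written in the basis given by the rows of P.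
  There a becomes \<open>gen_mat\<close> up to sign and the transvection a^-1 b becomes the start of
  the chain, so \<open>K\<close> contains every matrix preserving the standard form; conjugating
  back gives the claim.\<close>

lemma symplectic_subset_conjugate:
  assumes "matrix_subgroup 6 H"
    and c: "P \<in> carrier_mat 6 6" "Q \<in> carrier_mat 6 6" "J \<in> carrier_mat 6 6"
    and QP: "Q * P = 1\<^sub>m 6" and PQ: "P * Q = 1\<^sub>m 6"
    and PJ: "P * J * P\<^sup>T = symp_form 3"
    and pres: "\<And>h. h \<in> H \<Longrightarrow> preserves J h"
    and ab: "a \<in> H" "b \<in> H" "a * transvection J (rowf 6 (unitf 5)) = b"
    and conj: "P * a = gen_mat * P \<or> P * a = - (gen_mat * P)"
    and start: "rowf 6 ((!) [5, 3, - 6, 0, - 3, 4]) * P = rowf 6 (unitf 5)"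
    and h: "h \<in> carrier_mat 6 6" "preserves J h"
  shows "h \<in> H"
proof -
  interpret H: matrix_subgroup 6 H by fact
  define K where "K = {M \<in> carrier_mat 6 6. Q * M * P \<in> H}"
  have PQM: "P * (Q * M * P) * Q = M" "Q * (P * M * Q) * P = M" if M: "M \<in> carrier_mat 6 6" for M
  proof -
    have "P * (Q * M * P) * Q = (P * Q) * M * (P * Q)" "Q * (P * M * Q) * P = (Q * P) * M * (Q * P)"
      using c M by (simp_all add: assoc_mult_mat[of _ 6 6 _ 6 _ 6])
    then show "P * (Q * M * P) * Q = M" "Q * (P * M * Q) * P = M" using QP PQ M by auto
  qed
  have prod: "Q * (M * N) * P = (Q * M * P) * (Q * N * P)"
    if "M \<in> carrier_mat 6 6" "N \<in> carrier_mat 6 6" for M N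
  proof -
    have "(Q * M * P) * (Q * N * P) = Q * (M * (P * Q) * N) * P"
      using c that by (simp add: assoc_mult_mat[of _ 6 6 _ 6 _ 6])
    then show ?thesis using PQ that by simp
  qed
  have conj_in_K: "P * k * Q \<in> K" if "k \<in> H" for k
    using that H.K_carrier[OF that] PQM(2)[OF H.K_carrier[OF that]] c by (simp add: K_def)
  have K: "symplectic_subgroup 3 K"
  proof
    show "M \<in> carrier_mat (2 * 3) (2 * 3)" if "M \<in> K" for M using that by (simp add: K_def)
    show "1\<^sub>m (2 * 3) \<in> K" using c QP H.K_one by (simp add: K_def)
    show "M * N \<in> K" if "M \<in> K" "N \<in> K" for M N
      using that prod[of M N] H.K_mult mult_carrier_mat[of M 6 6 N 6] by (simp add: K_def)
    show "\<exists>N\<in>K. M * N = 1\<^sub>m (2 * 3) \<and> N * M = 1\<^sub>m (2 * 3)" if M: "M \<in> K" for M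
    proof -
      have Mc: "M \<in> carrier_mat 6 6" "Q * M * P \<in> H" using M by (auto simp: K_def)
      obtain g where g: "g \<in> H" "Q * M * P * g = 1\<^sub>m 6" "g * (Q * M * P) = 1\<^sub>m 6"
        using H.K_inv[OF Mc(2)] by blast
      have gc: "g \<in> carrier_mat 6 6" using H.K_carrier g(1) by blast
      have "M * (P * g * Q) = P * (Q * M * P * g) * Q" "(P * g * Q) * M = P * (g * (Q * M * P)) * Q"
        using PQM(1)[OF Mc(1)] PQ Mc gc c
        by (simp_all add: assoc_mult_mat[of _ 6 6 _ 6 _ 6] assoc_mult_mat[of P 6 6 Q 6 _ 6, symmetric])
      then show ?thesis using g PQ c conj_in_K[OF g(1)] by (intro bexI[of _ "P * g * Q"]) simp_all
    qed
    show "preserves (symp_form 3) M" if M: "M \<in> K" for M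
    proof -
      have Mc: "M \<in> carrier_mat 6 6" "Q * M * P \<in> H" using M by (auto simp: K_def)
      show ?thesis
        using preserves_base_change[OF c H.K_carrier[OF Mc(2)] QP PJ pres[OF Mc(2)]] PQM(1)[OF Mc(1)] by simp
    qed
  qed
  have "gen_mat \<in> K \<or> - gen_mat \<in> K"
  proof -
    have ac: "a \<in> carrier_mat 6 6" using H.K_carrier ab(1) by blast
    have gc: "gen_mat \<in> carrier_mat 6 6" by (simp add: gen_mat_def)
    have "gen_mat * P * Q = gen_mat" using assoc_mult_mat[OF gc c(1,2)] PQ gc by simp
    then have "P * a * Q = gen_mat \<or> P * a * Q = - gen_mat" using conj gc c by auto
    then show ?thesis using conj_in_K[OF ab(1)] by auto
  qed
  moreover have "transvection (symp_form 3) (rowf 6 ((!) [5, 3, - 6, 0, - 3, 4])) \<in> K"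
  proof -
    let ?T = "transvection J (rowf 6 (unitf 5))"
    have T: "?T \<in> carrier_mat 6 6" by (rule transvection_carrier[OF c(3) rowf_carrier(1)])
    \<comment> \<open>g is the inverse of a, so g b is the transvection along the last unit
      vector.\<close>
    obtain g where g: "g \<in> H" "g * a = 1\<^sub>m 6" using H.K_inv[OF ab(1)] by blast
    have "g * b = g * a * ?T"
      using assoc_mult_mat[OF H.K_carrier[OF g(1)] H.K_carrier[OF ab(1)] T] ab(3) by simp
    then have "g * b = ?T" using g(2) T by simp
    then have "?T \<in> H" using H.K_mult[OF g(1) ab(2)] by simp
    then show ?thesis
      using transvection_base_change[OF c rowf_carrier(1) QP PJ, of "(!) [5, 3, - 6, 0, - 3, 4]"] start
        transvection_carrier[OF symp_form_carrier(1)[of 3] rowf_carrier(1)]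
      by (simp add: K_def)
  qed
  ultimately interpret symplectic_transvections 3 K
    by (rule symplectic_transvections_6[OF K])
  have "P * h * Q \<in> K"
    using symplectic_subset preserves_base_change[OF c h(1) QP PJ h(2)] c h by simp
  then show ?thesis using PQM(2)[OF h(1)] by (simp add: K_def)
qed

section \<open>The two hypergeometric groups\<close>

text \<open>Products on lists can be evaluated by \<open>code_simp\<close>; most identities between
  explicit matrices below are reduced to it.\<close>

definition list_mult :: "int list list \<Rightarrow> int list list \<Rightarrow> int list list" where
  "list_mult r s = map (\<lambda>i. map (\<lambda>j. sum_list (map (\<lambda>k. r ! i ! k * s ! k ! j) [0..<6])) [0..<6]) [0..<6]"

definition list_transpose :: "int list list \<Rightarrow> int list list" where
  "list_transpose r = map (\<lambda>i. map (\<lambda>j. r ! j ! i) [0..<6]) [0..<6]"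

lemma mat6_mult: "mat6 r * mat6 s = mat6 (list_mult r s)"
  by (rule mat6_mult_eq) (simp add: list_mult_def interv_sum_list_conv_sum_set_nat lessThan_atLeast0)

lemma mat6_transpose: "(mat6 r)\<^sup>T = mat6 (list_transpose r)"
  by (rule eq_matI) (simp_all add: mat6_def list_transpose_def)

lemma mat6_one:
  "1\<^sub>m 6 = mat6 [[1, 0, 0, 0, 0, 0], [0, 1, 0, 0, 0, 0], [0, 0, 1, 0, 0, 0],
     [0, 0, 0, 1, 0, 0], [0, 0, 0, 0, 1, 0], [0, 0, 0, 0, 0, 1 :: int]]"
proof -
  have "\<forall>i<6. \<forall>j<6. (if i = j then 1 else 0) = [[1, 0, 0, 0, 0, 0], [0, 1, 0, 0, 0, 0], [0, 0, 1, 0, 0, 0],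
     [0, 0, 0, 1, 0, 0], [0, 0, 0, 0, 1, 0], [0, 0, 0, 0, 0, 1 :: int]] ! i ! j"
    by (simp add: all_less_6)
  then show ?thesis by (intro eq_matI) (auto simp: mat6_index)
qed

lemma mat6_symp_form:
  "symp_form 3 = mat6 [[0, 0, 0, 1, 0, 0], [0, 0, 0, 0, 1, 0], [0, 0, 0, 0, 0, 1],
     [- 1, 0, 0, 0, 0, 0], [0, - 1, 0, 0, 0, 0], [0, 0, - 1, 0, 0, 0]]"
proof -
  have "\<forall>i<6. \<forall>j<6. symp_form 3 $$ (i, j) = [[0, 0, 0, 1, 0, 0], [0, 0, 0, 0, 1, 0], [0, 0, 0, 0, 0, 1],
     [- 1, 0, 0, 0, 0, 0], [0, - 1, 0, 0, 0, 0], [0, 0, - 1, 0, 0, 0]] ! i ! j"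
    by (simp add: all_less_6 symp_form_def)
  then show ?thesis by (intro eq_matI) (auto simp: mat6_index)
qed

lemma mat6_uminus:
  "\<forall>i<6. \<forall>j<6. r ! i ! j = - (s ! i ! j :: int) \<Longrightarrow> mat6 r = - mat6 s"
  by (intro eq_matI) (auto simp: mat6_index)

lemma mat6_multI: "list_mult r s = t \<Longrightarrow> mat6 r * mat6 s = mat6 t"
  by (simp add: mat6_mult)

lemma mat6_congruenceI:
  "list_mult (list_mult r s) (list_transpose r) = t \<Longrightarrow> mat6 r * mat6 s * (mat6 r)\<^sup>T = mat6 t"
  by (simp add: mat6_mult mat6_transpose)

text \<open>For the last unit vector u, J u^T u has the last column of J as its last column and
  zeros elsewhere. Multiplying by this transvection changes only the last column, as does passing
  between companion matrices of equal size.\<close>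

lemma mat6_transvection_last:
  "transvection (mat6 r) (rowf 6 (unitf 5)) = mat6
    [[1, 0, 0, 0, 0, r ! 0 ! 5], [0, 1, 0, 0, 0, r ! 1 ! 5], [0, 0, 1, 0, 0, r ! 2 ! 5],
     [0, 0, 0, 1, 0, r ! 3 ! 5], [0, 0, 0, 0, 1, r ! 4 ! 5], [0, 0, 0, 0, 0, 1 + r ! 5 ! 5]]"
  (is "_ = mat6 ?t")
proof (rule eq_matI)
  fix i j
  assume "i < dim_row (mat6 ?t)" "j < dim_col (mat6 ?t)"
  then have ij: "i < 6" "j < 6" by auto
  let ?u = "rowf 6 (unitf 5)" and ?B = "mat6 r * (rowf 6 (unitf 5))\<^sup>T"
  have B: "?B $$ (i, 0) = r ! i ! 5" "dim_row ?B = 6" "dim_col ?B = 1"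
    using ij by (simp_all add: mat6_def rowf_def scalar_prod_def lessThan_atLeast0[symmetric] sum_6)
  have outer: "(X * ?u) $$ (i, j) = X $$ (i, 0) * unitf 5 j" if "dim_row X = 6" "dim_col X = 1" for X
    using that ij by (simp add: scalar_prod_def rowf_def)
  have "\<forall>i<6. \<forall>j<6. (if i = j then 1 else 0) + r ! i ! 5 * unitf 5 j = ?t ! i ! j"
    by (simp add: all_less_6)
  moreover have "transvection (mat6 r) ?u $$ (i, j) = (if i = j then 1 else 0) + (?B * ?u) $$ (i, j)"
    using ij by (simp add: transvection_def rowf_def del: index_mult_mat(1))
  ultimately show "transvection (mat6 r) ?u $$ (i, j) = mat6 ?t $$ (i, j)"
    using ij outer[OF B(2,3)] B(1) by (simp add: mat6_index del: index_mult_mat(1))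
qed (auto simp: transvection_def rowf_def)

lemma rowf_mult_mat6:
  "rowf 6 v * mat6 r = rowf 6 (\<lambda>j. \<Sum>k<6. v k * r ! k ! j)"
  by (rule eq_matI) (auto simp: rowf_def mat6_def scalar_prod_def lessThan_atLeast0)

lemma companion_mat6:
  assumes "degree f = 6" "\<forall>i<6. coeff f i = c ! i"
  shows "companion f = mat6 [[0, 0, 0, 0, 0, - (c ! 0)], [1, 0, 0, 0, 0, - (c ! 1)],
    [0, 1, 0, 0, 0, - (c ! 2)], [0, 0, 1, 0, 0, - (c ! 3)], [0, 0, 0, 1, 0, - (c ! 4)],
    [0, 0, 0, 0, 1, - (c ! 5)]]"
proof -
  have "\<forall>i<6. \<forall>j<6. companion f $$ (i, j) = [[0, 0, 0, 0, 0, - (c ! 0)], [1, 0, 0, 0, 0, - (c ! 1)],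
    [0, 1, 0, 0, 0, - (c ! 2)], [0, 0, 1, 0, 0, - (c ! 3)], [0, 0, 0, 1, 0, - (c ! 4)],
    [0, 0, 0, 0, 1, - (c ! 5)]] ! i ! j"
    using assms by (simp add: all_less_6 companion_def)
  then show ?thesis using assms(1) by (intro eq_matI) (auto simp: mat6_index companion_def)
qed

lemma arithmetic_hypergeometric_6I:
  assumes deg: "degree f = 6" "degree g = 6" and neq: "\<exists>i<degree f. coeff f i \<noteq> coeff g i"
    and A: "A' \<in> carrier_mat 6 6" "companion f * A' = 1\<^sub>m 6" "A' * companion f = 1\<^sub>m 6"
    and B: "B' \<in> carrier_mat 6 6" "companion g * B' = 1\<^sub>m 6" "B' * companion g = 1\<^sub>m 6"
    and J: "J \<in> carrier_mat 6 6" "J\<^sup>T = - J" "preserves J (companion f)" "preserves J (companion g)"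
    and P: "P \<in> carrier_mat 6 6" "Q \<in> carrier_mat 6 6" "Q * P = 1\<^sub>m 6" "P * Q = 1\<^sub>m 6"
    and PJ: "P * J * P\<^sup>T = symp_form 3"
    and ab: "(a, b) = (companion f, companion g) \<or> (a, b) = (companion g, companion f)"
      "a * transvection J (rowf 6 (unitf 5)) = b"
    and conj: "P * a = gen_mat * P \<or> P * a = - (gen_mat * P)"
    and start: "rowf 6 ((!) [5, 3, - 6, 0, - 3, 4]) * P = rowf 6 (unitf 5)"
  shows "arithmetic_hypergeometric f g"
proof (rule arithmetic_hypergeometricI)
  let ?H = "hypergeometric_group f g"
  have "companion f \<in> carrier_mat 6 6" "companion g \<in> carrier_mat 6 6"
    using deg by (simp_all add: companion_def)
  then show GL: "companion f \<in> carrier (GL_int (degree f))" "companion g \<in> carrier (GL_int (degree f))"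
    using A B deg by (auto simp: GL_int_carrier_iff)
  show fg: "degree g = degree f" using deg by simp
  note sub = hypergeometric_subgroup[OF fg GL]
  \<comment> \<open>The standard form is orthogonal as a matrix, so its determinant is nonzero; by
    congruence that determinant is a multiple of det J.\<close>
  show "det J \<noteq> 0"
  proof
    assume "det J = 0"
    then have "det (symp_form 3) = 0"
      using P J det_mult[OF mult_carrier_mat[OF P(1) J(1)], of "P\<^sup>T"] det_mult[OF P(1) J(1)]
      by (simp add: PJ[symmetric])
    moreover have "symp_form 3 * (symp_form 3)\<^sup>T = 1\<^sub>m 6"
      unfolding mat6_symp_form mat6_one mat6_transpose by (rule mat6_multI) code_simp
    ultimately show False
      using det_mult[of "symp_form 3" 6 "(symp_form 3)\<^sup>T"] symp_form_carrier(1)[of 3] by simp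
  qed
  show "preserves J (companion f)" "preserves J (companion g)" "J\<^sup>T = - J" by fact+
  show "J \<in> carrier_mat (degree f) (degree f)" using J deg by simp
  show "\<exists>i<degree f. coeff f i \<noteq> coeff g i" by fact
  show "0 < degree f" using deg by simp
  show "h \<in> ?H" if h: "h \<in> carrier_mat (degree f) (degree f)" "preserves J h" for h
  proof (rule symplectic_subset_conjugate[OF _ P(1,2) J(1) P(3,4) PJ _ _ _ ab(2) conj start])
    show "matrix_subgroup 6 ?H" using subgroup_matrix_subgroup[OF sub(1)] deg by simp
    show "preserves J k" if "k \<in> ?H" for k
      using hypergeometric_group_preserves[OF fg GL _ J(3,4) that] J(1) deg by simp
    show "a \<in> ?H" "b \<in> ?H" using ab(1) sub by auto
    show "h \<in> carrier_mat 6 6" "preserves J h" using h deg by simp_all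
  qed
qed

lemma arithmetic_case_1:
  "arithmetic_hypergeometric
    [:1, -1, 1, -1, 1, -1, 1:]
    ([:1, 1, 1:] * [:1, 1, 1, 1, 1:])"
proof -
  let ?f = "[:1, -1, 1, -1, 1, -1, 1:] :: int poly" and ?g = "([:1, 1, 1:] * [:1, 1, 1, 1, 1:]) :: int poly"
  let ?A = "mat6
      [[0, 0, 0, 0, 0, - 1],
       [1, 0, 0, 0, 0, 1],
       [0, 1, 0, 0, 0, - 1],
       [0, 0, 1, 0, 0, 1],
       [0, 0, 0, 1, 0, - 1],
       [0, 0, 0, 0, 1, 1]] :: int mat"
  let ?B = "mat6
      [[0, 0, 0, 0, 0, - 1],
       [1, 0, 0, 0, 0, - 2],
       [0, 1, 0, 0, 0, - 3],
       [0, 0, 1, 0, 0, - 3],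
       [0, 0, 0, 1, 0, - 3],
       [0, 0, 0, 0, 1, - 2]] :: int mat"
  \<comment> \<open>The last column is B^-1 applied to the last column of A - B, as B T_u = A
    requires; invariance determines the rest.\<close>
  let ?J = "mat6
      [[0, 3, 2, 4, 2, 3],
       [- 3, 0, - 2, 1, - 1, 2],
       [- 2, 2, 0, 4, 1, 4],
       [- 4, - 1, - 4, 0, - 2, 2],
       [- 2, 1, - 1, 2, 0, 3],
       [- 3, - 2, - 4, - 2, - 3, 0]] :: int mat"
  \<comment> \<open>The rows form a symplectic basis for \<open>?J\<close>, in the order e_0, e_1,
    e_2, f_0, f_1, f_2.\<close>
  let ?P = "mat6
      [[0, 2, - 1, 0, 0, - 1],
       [0, 1, 0, - 1, - 1, 1],
       [0, 1, 1, - 1, 0, 0],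
       [- 1, - 4, 2, - 1, 0, 3],
       [0, 1, - 1, 1, - 1, - 1],
       [0, - 1, 2, 0, 0, 0]] :: int mat"
  let ?A' = "mat6
      [[1, 1, 0, 0, 0, 0],
       [- 1, 0, 1, 0, 0, 0],
       [1, 0, 0, 1, 0, 0],
       [- 1, 0, 0, 0, 1, 0],
       [1, 0, 0, 0, 0, 1],
       [- 1, 0, 0, 0, 0, 0]] :: int mat"
  let ?B' = "mat6
      [[- 2, 1, 0, 0, 0, 0],
       [- 3, 0, 1, 0, 0, 0],
       [- 3, 0, 0, 1, 0, 0],
       [- 3, 0, 0, 0, 1, 0],
       [- 2, 0, 0, 0, 0, 1],
       [- 1, 0, 0, 0, 0, 0]] :: int mat"
  \<comment> \<open>The inverse of \<open>?P\<close>; its last row is the start of the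
    chain.\<close>
  let ?Q = "mat6
      [[- 3, 0, 1, - 1, 0, - 1],
       [4, 2, - 4, 0, - 2, 3],
       [2, 1, - 2, 0, - 1, 2],
       [6, 3, - 7, 0, - 3, 5],
       [3, 1, - 3, 0, - 2, 2],
       [5, 3, - 6, 0, - 3, 4]] :: int mat"
  have deg: "degree ?f = 6" "degree ?g = 6" by simp_all
  have coeff: "\<forall>i<6. coeff ?f i = [1, - 1, 1, - 1, 1, - 1] ! i" "\<forall>i<6. coeff ?g i = [1, 2, 3, 3, 3, 2] ! i"
    unfolding all_less_6 by (simp_all add: eval_nat_numeral)
  have comp: "companion ?f = ?A" "companion ?g = ?B"
    using companion_mat6[OF deg(1) coeff(1)] companion_mat6[OF deg(2) coeff(2)] by simp_all
  show ?thesis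
  proof (rule arithmetic_hypergeometric_6I[of ?f ?g _ _ ?J ?P _ "companion ?g" "companion ?f"])
    show "degree ?f = 6" "degree ?g = 6" by fact+
    show "\<exists>i<degree ?f. coeff ?f i \<noteq> coeff ?g i"
      unfolding deg using coeff[unfolded all_less_6] by (intro exI[of _ 1]) simp
    show "companion ?f * ?A' = 1\<^sub>m 6" "?A' * companion ?f = 1\<^sub>m 6"
      "companion ?g * ?B' = 1\<^sub>m 6" "?B' * companion ?g = 1\<^sub>m 6"
      "?Q * ?P = 1\<^sub>m 6" "?P * ?Q = 1\<^sub>m 6"
      unfolding comp mat6_one by (rule mat6_multI; code_simp)+
    show "?P * ?J * ?P\<^sup>T = symp_form 3"
      unfolding mat6_symp_form by (rule mat6_congruenceI) code_simp
    show "preserves ?J (companion ?f)" "preserves ?J (companion ?g)"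
      unfolding preserves_def comp by (rule mat6_congruenceI; code_simp)+
    show "?J\<^sup>T = - ?J"
      unfolding mat6_transpose by (rule mat6_uminus) (simp add: all_less_6 list_transpose_def)
    show "companion ?g * transvection ?J (rowf 6 (unitf 5)) = companion ?f"
      unfolding comp mat6_transvection_last by (rule mat6_multI) code_simp
    show "rowf 6 ((!) [5, 3, - 6, 0, - 3, 4]) * ?P = rowf 6 (unitf 5)"
      by (simp add: rowf_mult_mat6 rowf_eq_iff all_less_6 sum_6)
    show "?P * companion ?g = gen_mat * ?P \<or> ?P * companion ?g = - (gen_mat * ?P)"
      unfolding comp gen_mat_def mat6_mult
      by (rule disjI2, rule mat6_uminus, unfold all_less_6) code_simp
  qed simp_all
qed

text \<open>Let S = diag(1, -1, 1, -1, 1, -1). The companion matrices are -S X S for those X of the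
  other pair, in exchanged order. Accordingly J becomes S J S and P becomes -P S; the minus sign
  preserves the last column of P and with it the start of the chain.\<close>

lemma arithmetic_case_2:
  "arithmetic_hypergeometric
    ([:1, -1, 1:] * [:1, -1, 1, -1, 1:])
    [:1, 1, 1, 1, 1, 1, 1:]"
proof -
  let ?f = "([:1, -1, 1:] * [:1, -1, 1, -1, 1:]) :: int poly" and ?g = "[:1, 1, 1, 1, 1, 1, 1:] :: int poly"
  let ?A = "mat6
      [[0, 0, 0, 0, 0, - 1],
       [1, 0, 0, 0, 0, 2],
       [0, 1, 0, 0, 0, - 3],
       [0, 0, 1, 0, 0, 3],
       [0, 0, 0, 1, 0, - 3],
       [0, 0, 0, 0, 1, 2]] :: int mat"
  let ?B = "mat6
      [[0, 0, 0, 0, 0, - 1],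
       [1, 0, 0, 0, 0, - 1],
       [0, 1, 0, 0, 0, - 1],
       [0, 0, 1, 0, 0, - 1],
       [0, 0, 0, 1, 0, - 1],
       [0, 0, 0, 0, 1, - 1]] :: int mat"
  let ?J = "mat6
      [[0, - 3, 2, - 4, 2, - 3],
       [3, 0, 2, 1, 1, 2],
       [- 2, - 2, 0, - 4, 1, - 4],
       [4, - 1, 4, 0, 2, 2],
       [- 2, - 1, - 1, - 2, 0, - 3],
       [3, - 2, 4, - 2, 3, 0]] :: int mat"
  let ?P = "mat6
      [[0, 2, 1, 0, 0, - 1],
       [0, 1, 0, - 1, 1, 1],
       [0, 1, - 1, - 1, 0, 0],
       [1, - 4, - 2, - 1, 0, 3],
       [0, 1, 1, 1, 1, - 1],
       [0, - 1, - 2, 0, 0, 0]] :: int mat"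
  let ?A' = "mat6
      [[2, 1, 0, 0, 0, 0],
       [- 3, 0, 1, 0, 0, 0],
       [3, 0, 0, 1, 0, 0],
       [- 3, 0, 0, 0, 1, 0],
       [2, 0, 0, 0, 0, 1],
       [- 1, 0, 0, 0, 0, 0]] :: int mat"
  let ?B' = "mat6
      [[- 1, 1, 0, 0, 0, 0],
       [- 1, 0, 1, 0, 0, 0],
       [- 1, 0, 0, 1, 0, 0],
       [- 1, 0, 0, 0, 1, 0],
       [- 1, 0, 0, 0, 0, 1],
       [- 1, 0, 0, 0, 0, 0]] :: int mat"
  let ?Q = "mat6
      [[3, 0, - 1, 1, 0, 1],
       [4, 2, - 4, 0, - 2, 3],
       [- 2, - 1, 2, 0, 1, - 2],
       [6, 3, - 7, 0, - 3, 5],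
       [- 3, - 1, 3, 0, 2, - 2],
       [5, 3, - 6, 0, - 3, 4]] :: int mat"
  have deg: "degree ?f = 6" "degree ?g = 6" by simp_all
  have coeff: "\<forall>i<6. coeff ?f i = [1, - 2, 3, - 3, 3, - 2] ! i" "\<forall>i<6. coeff ?g i = [1, 1, 1, 1, 1, 1] ! i"
    unfolding all_less_6 by (simp_all add: eval_nat_numeral)
  have comp: "companion ?f = ?A" "companion ?g = ?B"
    using companion_mat6[OF deg(1) coeff(1)] companion_mat6[OF deg(2) coeff(2)] by simp_all
  show ?thesis
  proof (rule arithmetic_hypergeometric_6I[of ?f ?g _ _ ?J ?P _ "companion ?f" "companion ?g"])
    show "degree ?f = 6" "degree ?g = 6" by fact+
    show "\<exists>i<degree ?f. coeff ?f i \<noteq> coeff ?g i"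
      unfolding deg using coeff[unfolded all_less_6] by (intro exI[of _ 1]) simp
    show "companion ?f * ?A' = 1\<^sub>m 6" "?A' * companion ?f = 1\<^sub>m 6"
      "companion ?g * ?B' = 1\<^sub>m 6" "?B' * companion ?g = 1\<^sub>m 6"
      "?Q * ?P = 1\<^sub>m 6" "?P * ?Q = 1\<^sub>m 6"
      unfolding comp mat6_one by (rule mat6_multI; code_simp)+
    show "?P * ?J * ?P\<^sup>T = symp_form 3"
      unfolding mat6_symp_form by (rule mat6_congruenceI) code_simp
    show "preserves ?J (companion ?f)" "preserves ?J (companion ?g)"
      unfolding preserves_def comp by (rule mat6_congruenceI; code_simp)+
    show "?J\<^sup>T = - ?J"
      unfolding mat6_transpose by (rule mat6_uminus) (simp add: all_less_6 list_transpose_def)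
    show "companion ?f * transvection ?J (rowf 6 (unitf 5)) = companion ?g"
      unfolding comp mat6_transvection_last by (rule mat6_multI) code_simp
    show "rowf 6 ((!) [5, 3, - 6, 0, - 3, 4]) * ?P = rowf 6 (unitf 5)"
      by (simp add: rowf_mult_mat6 rowf_eq_iff all_less_6 sum_6)
    show "?P * companion ?f = gen_mat * ?P \<or> ?P * companion ?f = - (gen_mat * ?P)"
      unfolding comp gen_mat_def mat6_mult
      by (rule disjI1, rule arg_cong[of _ _ mat6]) code_simp
  qed simp_all
qed

theorem mainTheorem3:
  shows "arithmetic_hypergeometric
           [:1, -1, 1, -1, 1, -1, 1:]
           ([:1, 1, 1:] * [:1, 1, 1, 1, 1:]) \<and>
         arithmetic_hypergeometric
           ([:1, -1, 1:] * [:1, -1, 1, -1, 1:])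
           [:1, 1, 1, 1, 1, 1, 1:]"
  using arithmetic_case_1 arithmetic_case_2 by blast

end
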